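(* Let $\mathfrak n$ be a $7$-dimensional nilpotent Lie algebra whose dual has a basis $\{e^1,\dots,e^7\}$ with $de^1=de^2=de^3=de^4=0$ and $$de^5=\delta\sigma_1^++\epsilon_1\sigma_1^-,\qquad de^6=\delta\sigma_2^++\epsilon_2\sigma_2^-,\qquad de^7=\delta\sigma_3^++\epsilon_3\sigma_3^-,$$ with $\delta,\epsilon_1,\epsilon_2,\epsilon_3\in\mathbb R$ and $\delta\neq0$. Consider on $\mathfrak n$ the $\mathrm G_2$-structure $$\varphi=\sigma_1^+\wedge e^5+\sigma_2^+\wedge e^6+\sigma_3^+\wedge e^7+e^{567}$$ together with the connection $A=Y_5e^5+Y_6e^6+Y_7e^7$ with gauge group $G=\mathrm{SU}(2)$, where $\{Y_5,Y_6,Y_7\}$ is a basis of $\mathfrak g=\mathfrak{su}(2)$ with $$[Y_6,Y_7]=-2\delta Y_5,\quad [Y_7,Y_5]=-2\delta Y_6,\quad [Y_5,Y_6]=-2\delta Y_7.$$ Then $\varphi$ defines a co-closed $\mathrm G_2$-structure (with $\tau_0\neq0$), $A$ is a $\mathrm G_2$-instanton with respect to $\varphi$, and $(\varphi,A)$ solves the heterotic Bianchi identity $dT_\varphi=\langle F_A\wedge F_A\rangle_{\mathfrak g}$ for the $\mathrm{ad}$-invariant pairing $\langle\cdot,\cdot\rangle_{\mathfrak g}=-(8\delta^2)^{-1}\kappa$, where $\kappa$ denotes the Killing form of $\mathfrak{su}(2)$.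
   Context: Write $e^{ij}=e^i\wedge e^j$, etc., and $\sigma_1^+=e^{13}-e^{24}$, $\sigma_2^+=-e^{14}-e^{23}$, $\sigma_3^+=e^{12}+e^{34}$; $\sigma_1^-=e^{13}+e^{24}$, $\sigma_2^-=e^{14}-e^{23}$, $\sigma_3^-=e^{12}-e^{34}$. All forms are viewed as left-invariant forms on the simply connected Lie group $N$ with Lie algebra $\mathfrak n$, and $A$ as a connection on the trivial $\mathrm{SU}(2)$-bundle over $N$, with curvature $F_A=dA+\frac12[A\wedge A]$. A $\mathrm G_2$-structure $\varphi$ determines $g_\varphi,\mathrm{vol}_\varphi$ by $6g_\varphi(X,Y)\mathrm{vol}_\varphi=(X\lrcorner\varphi)\wedge(Y\lrcorner\varphi)\wedge\varphi$, and Hodge star $\star$. Put $\psi=\star\varphi$, $\tau_0=\frac17\star(d\varphi\wedge\varphi)$, $\tau_1=\frac1{12}\star(\varphi\wedge\star d\varphi)$, $T_\varphi=\frac16\star(d\varphi\wedge\varphi)\varphi-\star d\varphi+\star(4\tau_1\wedge\varphi)$. $\varphi$ is co-closed if $d\psi=0$; $A$ is a $\mathrm G_2$-instanton if $F_A\wedge\psi=0$. *)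

theory Defs
  imports
    "HOL-Analysis.Analysis"
    "HOL-Combinatorics.Permutations"
    "HOL-Library.Function_Algebras"
begin

text \<open>
  Left-invariant forms on a simply connected Lie group are identified with alternating multilinear
  forms on its Lie algebra, and the exterior derivative with the Chevalley--Eilenberg differential.
  A \<open>k\<close>-form on a real vector space \<open>'n\<close> with values in \<open>'v\<close> is encoded as a function on lists of
  vectors which is multilinear and alternating on lists of length \<open>k\<close> and zero on all other lists.
  So forms of all degrees share one type, the operations need no degree arguments, and equality of
  forms is equality of functions.
\<close>

instantiation "fun" :: (type, real_vector) real_vector
begin

definition scaleR_fun :: "real \<Rightarrow> ('a \<Rightarrow> 'b) \<Rightarrow> 'a \<Rightarrow> 'b"
  where "scaleR_fun r f = (\<lambda>x. r *\<^sub>R f x)"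

instance
  by standard (auto simp: scaleR_fun_def fun_eq_iff scaleR_add_right scaleR_add_left)

end

section \<open>Lie algebras\<close>

definition lie_algebra :: "('n::real_vector \<Rightarrow> 'n \<Rightarrow> 'n) \<Rightarrow> bool" where
  "lie_algebra br \<longleftrightarrow>
     bilinear br \<and> (\<forall>x. br x x = 0) \<and>
     (\<forall>x y z. br x (br y z) + br y (br z x) + br z (br x y) = 0)"

fun lower_central :: "('n::real_vector \<Rightarrow> 'n \<Rightarrow> 'n) \<Rightarrow> nat \<Rightarrow> 'n set" where
  "lower_central br 0 = UNIV"
| "lower_central br (Suc k) = span {br x y | x y. y \<in> lower_central br k}"

definition nilpotent_lie_algebra :: "('n::real_vector \<Rightarrow> 'n \<Rightarrow> 'n) \<Rightarrow> bool" where
  "nilpotent_lie_algebra br \<longleftrightarrow> lie_algebra br \<and> (\<exists>k. lower_central br k = {0})"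

text \<open>The value does not depend on the chosen basis when \<open>f\<close> is a linear endomorphism of the
  finite-dimensional subspace \<open>S\<close>.\<close>

definition trace_on :: "'v::real_vector set \<Rightarrow> ('v \<Rightarrow> 'v) \<Rightarrow> real" where
  "trace_on S f =
     (let B = (SOME B. independent B \<and> span B = S) in \<Sum>b\<in>B. representation B (f b) b)"

definition killing_form :: "'v::real_vector set \<Rightarrow> ('v \<Rightarrow> 'v \<Rightarrow> 'v) \<Rightarrow> 'v \<Rightarrow> 'v \<Rightarrow> real" where
  "killing_form S br X Y = trace_on S (\<lambda>Z. br X (br Y Z))"

definition ad_invariant ::
  "'v::real_vector set \<Rightarrow> ('v \<Rightarrow> 'v \<Rightarrow> 'v) \<Rightarrow> ('v \<Rightarrow> 'v \<Rightarrow> real) \<Rightarrow> bool" where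
  "ad_invariant S br B \<longleftrightarrow>
     (\<forall>X\<in>S. \<forall>Y\<in>S. \<forall>Z\<in>S. B (br Z X) Y + B X (br Z Y) = 0)"

definition su2 :: "(complex^2^2) set" where
  "su2 = {X. (\<chi> i j. cnj (X $ j $ i)) = - X \<and> trace X = 0}"

definition commutator :: "complex^2^2 \<Rightarrow> complex^2^2 \<Rightarrow> complex^2^2" where
  "commutator X Y = X ** Y - Y ** X"

section \<open>Exterior calculus\<close>

definition kform :: "nat \<Rightarrow> ('n::real_vector list \<Rightarrow> 'v::real_vector) \<Rightarrow> bool" where
  "kform k \<alpha> \<longleftrightarrow>
     (\<forall>vs. length vs \<noteq> k \<longrightarrow> \<alpha> vs = 0) \<and>
     (\<forall>vs i. length vs = k \<and> i < k \<longrightarrow> linear (\<lambda>x. \<alpha> (vs[i := x]))) \<and>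
     (\<forall>vs. length vs = k \<and> \<not> distinct vs \<longrightarrow> \<alpha> vs = 0)"

text \<open>Wedge product of vector-valued forms, combining values by a bilinear map \<open>B\<close>. For a \<open>p\<close>-form
  \<open>\<alpha>\<close> and a \<open>q\<close>-form \<open>\<beta>\<close> only one summand of the outer sum survives, giving
  \<open>1 / (p! q!)\<close> times the antisymmetrisation, so that \<open>(e \<and> f)(X, Y) = e X * f Y - e Y * f X\<close>.\<close>

definition wedge_with ::
  "('a::real_vector \<Rightarrow> 'b::real_vector \<Rightarrow> 'c::real_vector)
    \<Rightarrow> ('n list \<Rightarrow> 'a) \<Rightarrow> ('n list \<Rightarrow> 'b) \<Rightarrow> 'n list \<Rightarrow> 'c" where
  "wedge_with B \<alpha> \<beta> vs =
     (let n = length vs in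
      \<Sum>p\<le>n. (1 / (fact p * fact (n - p))) *\<^sub>R
        (\<Sum>\<pi> | \<pi> permutes {..<n}.
           of_int (sign \<pi>) *\<^sub>R
             B (\<alpha> (map (\<lambda>i. vs ! \<pi> i) [0..<p])) (\<beta> (map (\<lambda>i. vs ! \<pi> i) [p..<n]))))"

abbreviation wedge :: "('n list \<Rightarrow> real) \<Rightarrow> ('n list \<Rightarrow> real) \<Rightarrow> 'n list \<Rightarrow> real"
    (infixr "\<and>\<^sub>f" 77) where
  "\<alpha> \<and>\<^sub>f \<beta> \<equiv> wedge_with (*) \<alpha> \<beta>"

definition interior :: "'n \<Rightarrow> ('n list \<Rightarrow> 'v) \<Rightarrow> 'n list \<Rightarrow> 'v" where
  "interior X \<alpha> = (\<lambda>vs. \<alpha> (X # vs))"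

text \<open>Chevalley--Eilenberg differential; on 1-forms it is \<open>(d\<alpha>)(X, Y) = - \<alpha> [X, Y]\<close>.\<close>

definition ext_d ::
  "('n \<Rightarrow> 'n \<Rightarrow> 'n) \<Rightarrow> ('n list \<Rightarrow> 'v::real_vector) \<Rightarrow> 'n list \<Rightarrow> 'v" where
  "ext_d br \<alpha> vs =
     (\<Sum>j<length vs. \<Sum>i<j.
        (-1) ^ (i + j) *\<^sub>R \<alpha> (br (vs ! i) (vs ! j) # nths vs (- {i, j})))"

definition dual_basis :: "(nat \<Rightarrow> 'n::real_vector list \<Rightarrow> real) \<Rightarrow> nat \<Rightarrow> bool" where
  "dual_basis e n \<longleftrightarrow>
     inj_on e {1..n} \<and> independent (e ` {1..n}) \<and> span (e ` {1..n}) = {\<alpha>. kform 1 \<alpha>}"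

section \<open>Metric and Hodge star\<close>

definition inner_product :: "('n::real_vector \<Rightarrow> 'n \<Rightarrow> real) \<Rightarrow> bool" where
  "inner_product g \<longleftrightarrow>
     bilinear g \<and> (\<forall>x y. g x y = g y x) \<and> (\<forall>x. x \<noteq> 0 \<longrightarrow> 0 < g x x)"

definition orthonormal_frame :: "('n::real_vector \<Rightarrow> 'n \<Rightarrow> real) \<Rightarrow> 'n list \<Rightarrow> bool" where
  "orthonormal_frame g bs \<longleftrightarrow>
     length bs = dim (UNIV :: 'n set) \<and>
     (\<forall>i<length bs. \<forall>j<length bs. g (bs ! i) (bs ! j) = (if i = j then 1 else 0))"

definition volume_form ::
  "('n::real_vector \<Rightarrow> 'n \<Rightarrow> real) \<Rightarrow> ('n list \<Rightarrow> real) \<Rightarrow> bool" where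
  "volume_form g vol \<longleftrightarrow>
     kform (dim (UNIV :: 'n set)) vol \<and> (\<forall>bs. orthonormal_frame g bs \<longrightarrow> \<bar>vol bs\<bar> = 1)"

text \<open>The Hodge star in index notation,
  \<open>(\<star>\<beta>)(w\<^sub>1, \<dots>, w\<^sub>n\<^sub>-\<^sub>k) = 1/k! \<Sum> \<beta>(b\<^sub>i\<^sub>1, \<dots>, b\<^sub>i\<^sub>k) vol(b\<^sub>i\<^sub>1, \<dots>, b\<^sub>i\<^sub>k, w\<^sub>1, \<dots>, w\<^sub>n\<^sub>-\<^sub>k)\<close>,
  summed over all index tuples of an orthonormal frame \<open>b\<close>. This is the convention
  \<open>\<alpha> \<and> \<star>\<beta> = g(\<alpha>, \<beta>) vol\<close>; the result does not depend on the frame.\<close>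

definition hodge ::
  "('n::real_vector \<Rightarrow> 'n \<Rightarrow> real) \<Rightarrow> ('n list \<Rightarrow> real) \<Rightarrow> ('n list \<Rightarrow> real) \<Rightarrow> 'n list \<Rightarrow> real"
  where
  "hodge g vol \<beta> ws =
     (let bs = (SOME bs. orthonormal_frame g bs);
          k = dim (UNIV :: 'n set) - length ws
      in (1 / fact k) * (\<Sum>is | set is \<subseteq> set bs \<and> length is = k. \<beta> is * vol (is @ ws)))"

section \<open>\<open>G\<^sub>2\<close>-structures\<close>

text \<open>A \<open>G\<^sub>2\<close>-structure is a 3-form in the \<open>GL(7)\<close>-orbit of the standard model
  \<open>e\<^sup>1\<^sup>2\<^sup>3 + e\<^sup>1\<^sup>4\<^sup>5 + e\<^sup>1\<^sup>6\<^sup>7 + e\<^sup>2\<^sup>4\<^sup>6 - e\<^sup>2\<^sup>5\<^sup>7 - e\<^sup>3\<^sup>4\<^sup>7 - e\<^sup>3\<^sup>5\<^sup>6\<close>. All usual sign conventions for the model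
  give this same orbit, which is stable under \<open>\<phi> \<mapsto> - \<phi>\<close>.\<close>

definition g2_structure :: "('n::real_vector list \<Rightarrow> real) \<Rightarrow> bool" where
  "g2_structure \<phi> \<longleftrightarrow>
     (\<exists>f. dual_basis f 7 \<and>
       \<phi> = f 1 \<and>\<^sub>f f 2 \<and>\<^sub>f f 3 + f 1 \<and>\<^sub>f f 4 \<and>\<^sub>f f 5 + f 1 \<and>\<^sub>f f 6 \<and>\<^sub>f f 7 + f 2 \<and>\<^sub>f f 4 \<and>\<^sub>f f 6
         - f 2 \<and>\<^sub>f f 5 \<and>\<^sub>f f 7 - f 3 \<and>\<^sub>f f 4 \<and>\<^sub>f f 7 - f 3 \<and>\<^sub>f f 5 \<and>\<^sub>f f 6)"

definition is_g2_metric_vol ::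
  "('n::real_vector list \<Rightarrow> real) \<Rightarrow> ('n \<Rightarrow> 'n \<Rightarrow> real) \<Rightarrow> ('n list \<Rightarrow> real) \<Rightarrow> bool" where
  "is_g2_metric_vol \<phi> g vol \<longleftrightarrow>
     inner_product g \<and> volume_form g vol \<and>
     (\<forall>X Y. (6 * g X Y) *\<^sub>R vol = (interior X \<phi> \<and>\<^sub>f interior Y \<phi>) \<and>\<^sub>f \<phi>)"

definition g2_metric_vol ::
  "('n::real_vector list \<Rightarrow> real) \<Rightarrow> ('n \<Rightarrow> 'n \<Rightarrow> real) \<times> ('n list \<Rightarrow> real)" where
  "g2_metric_vol \<phi> = (THE gv. is_g2_metric_vol \<phi> (fst gv) (snd gv))"

definition g2_star ::
  "('n::real_vector list \<Rightarrow> real) \<Rightarrow> ('n list \<Rightarrow> real) \<Rightarrow> 'n list \<Rightarrow> real" where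
  "g2_star \<phi> = hodge (fst (g2_metric_vol \<phi>)) (snd (g2_metric_vol \<phi>))"

definition g2_psi :: "('n::real_vector list \<Rightarrow> real) \<Rightarrow> 'n list \<Rightarrow> real" where
  "g2_psi \<phi> = g2_star \<phi> \<phi>"

text \<open>A 0-form is identified with its value on the empty list.\<close>

definition tau0 :: "('n::real_vector \<Rightarrow> 'n \<Rightarrow> 'n) \<Rightarrow> ('n list \<Rightarrow> real) \<Rightarrow> real" where
  "tau0 br \<phi> = 1 / 7 * g2_star \<phi> (ext_d br \<phi> \<and>\<^sub>f \<phi>) []"

definition tau1 :: "('n::real_vector \<Rightarrow> 'n \<Rightarrow> 'n) \<Rightarrow> ('n list \<Rightarrow> real) \<Rightarrow> 'n list \<Rightarrow> real" where
  "tau1 br \<phi> = (1 / 12) *\<^sub>R g2_star \<phi> (\<phi> \<and>\<^sub>f g2_star \<phi> (ext_d br \<phi>))"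

definition g2_torsion ::
  "('n::real_vector \<Rightarrow> 'n \<Rightarrow> 'n) \<Rightarrow> ('n list \<Rightarrow> real) \<Rightarrow> 'n list \<Rightarrow> real" where
  "g2_torsion br \<phi> =
     (1 / 6 * g2_star \<phi> (ext_d br \<phi> \<and>\<^sub>f \<phi>) []) *\<^sub>R \<phi>
     - g2_star \<phi> (ext_d br \<phi>)
     + g2_star \<phi> ((4 *\<^sub>R tau1 br \<phi>) \<and>\<^sub>f \<phi>)"

definition coclosed :: "('n::real_vector \<Rightarrow> 'n \<Rightarrow> 'n) \<Rightarrow> ('n list \<Rightarrow> real) \<Rightarrow> bool" where
  "coclosed br \<phi> \<longleftrightarrow> ext_d br (g2_psi \<phi>) = 0"

section \<open>Connections on the trivial \<open>SU(2)\<close>-bundle\<close>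

definition su2_connection :: "('n::real_vector list \<Rightarrow> complex^2^2) \<Rightarrow> bool" where
  "su2_connection A \<longleftrightarrow> kform 1 A \<and> range A \<subseteq> su2"

definition curvature ::
  "('n \<Rightarrow> 'n \<Rightarrow> 'n) \<Rightarrow> ('n list \<Rightarrow> complex^2^2) \<Rightarrow> 'n list \<Rightarrow> complex^2^2" where
  "curvature br A = ext_d br A + (1 / 2 :: real) *\<^sub>R wedge_with commutator A A"

definition g2_instanton ::
  "('n::real_vector \<Rightarrow> 'n \<Rightarrow> 'n) \<Rightarrow> ('n list \<Rightarrow> real) \<Rightarrow> ('n list \<Rightarrow> complex^2^2) \<Rightarrow> bool" where
  "g2_instanton br \<phi> A \<longleftrightarrow>
     su2_connection A \<and> wedge_with (\<lambda>X r. r *\<^sub>R X) (curvature br A) (g2_psi \<phi>) = 0"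

definition heterotic_bianchi ::
  "('n::real_vector \<Rightarrow> 'n \<Rightarrow> 'n) \<Rightarrow> (complex^2^2 \<Rightarrow> complex^2^2 \<Rightarrow> real)
    \<Rightarrow> ('n list \<Rightarrow> real) \<Rightarrow> ('n list \<Rightarrow> complex^2^2) \<Rightarrow> bool" where
  "heterotic_bianchi br B \<phi> A \<longleftrightarrow>
     ext_d br (g2_torsion br \<phi>) = wedge_with B (curvature br A) (curvature br A)"

section \<open>The 2-forms \<open>\<sigma>\<^sub>i\<^sup>\<plusminus>\<close>\<close>

definition sigma_plus :: "(nat \<Rightarrow> 'n list \<Rightarrow> real) \<Rightarrow> nat \<Rightarrow> 'n list \<Rightarrow> real" where
  "sigma_plus e i =
     (if i = 1 then e 1 \<and>\<^sub>f e 3 - e 2 \<and>\<^sub>f e 4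
      else if i = 2 then - (e 1 \<and>\<^sub>f e 4) - e 2 \<and>\<^sub>f e 3
      else e 1 \<and>\<^sub>f e 2 + e 3 \<and>\<^sub>f e 4)"

definition sigma_minus :: "(nat \<Rightarrow> 'n list \<Rightarrow> real) \<Rightarrow> nat \<Rightarrow> 'n list \<Rightarrow> real" where
  "sigma_minus e i =
     (if i = 1 then e 1 \<and>\<^sub>f e 3 + e 2 \<and>\<^sub>f e 4
      else if i = 2 then e 1 \<and>\<^sub>f e 4 - e 2 \<and>\<^sub>f e 3
      else e 1 \<and>\<^sub>f e 2 - e 3 \<and>\<^sub>f e 4)"

end

theory Submission
  imports Defs "HOL-Combinatorics.Multiset_Permutations"
begin

text \<open>On exterior products of 1-forms every operation involved is mechanical once two facts are
  known: contraction with a vector is an antiderivation of the wedge product, and the differential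
  is \<open>d\<alpha> = \<Sum>i. d e\<^sup>i \<and> (b\<^sub>i \<lrcorner> \<alpha>)\<close> for the dual basis \<open>b\<close>. With \<open>g\<close> the metric making \<open>e\<close>
  orthonormal, \<open>(X \<lrcorner> \<phi>) \<and> (Y \<lrcorner> \<phi>) \<and> \<phi> = 6 g(X, Y) e\<^sup>1\<^sup>2\<^sup>3\<^sup>4\<^sup>5\<^sup>6\<^sup>7\<close>, and a scaling argument shows
  that no other pair \<open>(g, vol)\<close> qualifies. The Hodge star of a monomial is then the contraction of
  \<open>e\<^sup>1\<^sup>2\<^sup>3\<^sup>4\<^sup>5\<^sup>6\<^sup>7\<close>, which yields \<open>d\<psi> = 0\<close>, \<open>\<tau>\<^sub>1 = 0\<close>, \<open>\<star>(d\<phi> \<and> \<phi>) = 12 \<delta>\<close> and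
  \<open>T = de\<^sup>5 \<and> e\<^sup>5 + de\<^sup>6 \<and> e\<^sup>6 + de\<^sup>7 \<and> e\<^sup>7 - 4 \<delta> e\<^sup>5\<^sup>6\<^sup>7\<close>. The curvature has the components
  \<open>F\<^sub>5 = de\<^sup>5 - 2 \<delta> e\<^sup>6\<^sup>7\<close> and its cyclic analogues, and since the pairing makes \<open>Y\<^sub>5, Y\<^sub>6, Y\<^sub>7\<close>
  orthonormal, the Bianchi identity reads \<open>dT = F\<^sub>5 \<and> F\<^sub>5 + F\<^sub>6 \<and> F\<^sub>6 + F\<^sub>7 \<and> F\<^sub>7\<close>.\<close>

section \<open>Forms and the wedge product\<close>

text \<open>The wedge product is defined by a sum over all permutations of the arguments, 5040 of
  them in degree 7, so it is never evaluated directly. Forms are carried instead as lists of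
  coefficients and multi-indices, on which product, contraction, differential and star are computed
  without sorting; two lists are compared by their values on increasing tuples of basis vectors.
  What remains are finitely many polynomial identities in \<delta> and the \<epsilon>s. These hold
  for two reasons. First, \<sigma>_i^+ \<and> \<sigma>_j^+ is 2 e^{1234} for i = j and 0 otherwise,
  and \<sigma>_i^+ \<and> \<sigma>_j^- = 0, so the \<epsilon>s drop out of most products. Second, T
  is the Chern-Simons form <A \<and> dA> + 1/3 <A \<and> [A \<and> A]> of A, whose differential is
  <F \<and> F>; this ties the structure constant -2 \<delta> and the scale of the pairing to
  \<phi>.\<close>

lemma kform_linear:
  assumes "kform k \<alpha>" "length vs = k" "i < k"
  shows "linear (\<lambda>x. \<alpha> (vs[i := x]))"
  using assms unfolding kform_def by blast

lemma kform_eq_0_length: "kform k \<alpha> \<Longrightarrow> length vs \<noteq> k \<Longrightarrow> \<alpha> vs = 0"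
  unfolding kform_def by blast

lemma kform_eq_0_not_distinct: "kform k \<alpha> \<Longrightarrow> \<not> distinct vs \<Longrightarrow> \<alpha> vs = 0"
  unfolding kform_def by blast

lemma kform_0 [simp]: "kform k 0"
  by (auto simp: kform_def linear_iff)

lemma kform_add [intro]: "kform k \<alpha> \<Longrightarrow> kform k \<beta> \<Longrightarrow> kform k (\<alpha> + \<beta>)"
  unfolding kform_def by (auto intro!: linear_compose_add)

lemma kform_scaleR [intro]: "kform k \<alpha> \<Longrightarrow> kform k (c *\<^sub>R \<alpha>)"
  unfolding kform_def by (auto simp: scaleR_fun_def intro!: linear_compose_scale_right)

lemma kform_diff [intro]: "kform k \<alpha> \<Longrightarrow> kform k \<beta> \<Longrightarrow> kform k (\<alpha> - \<beta>)"
  unfolding kform_def by (auto intro!: linear_compose_sub)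

lemma kform_Suc_linear:
  assumes "kform (Suc k) \<alpha>"
  shows "linear (\<lambda>x. \<alpha> (x # vs))"
proof (cases "length vs = k")
  case True
  then show ?thesis
    using kform_linear[OF assms, of "undefined # vs" 0] by simp
next
  case False
  then have "(\<lambda>x. \<alpha> (x # vs)) = (\<lambda>x. 0)"
    using kform_eq_0_length[OF assms] by fastforce
  then show ?thesis by (simp add: linear_iff)
qed

text \<open>Alternation is given as vanishing on lists with a repeated entry; antisymmetry follows
  by polarisation, expanding the value with x + y in both slots.\<close>

lemma kform_swap:
  assumes \<alpha>: "kform k \<alpha>" and ij: "i < length vs" "j < length vs" "i \<noteq> j"
  shows "\<alpha> (vs[i := vs ! j, j := vs ! i]) = - \<alpha> vs"
proof (cases "length vs = k")
  case len: True
  let ?f = "\<lambda>x y. \<alpha> (vs[i := x, j := y])"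
  have lin2: "linear (?f x)" for x
    using kform_linear[OF \<alpha>, of "vs[i := x]" j] ij len by simp
  have lin1: "linear (\<lambda>x. ?f x y)" for y
    using kform_linear[OF \<alpha>, of "vs[j := y]" i] ij len by (simp add: list_update_swap)
  have diag: "?f x x = 0" for x
  proof (rule kform_eq_0_not_distinct[OF \<alpha>])
    have "vs[i := x, j := x] ! i = vs[i := x, j := x] ! j"
      using ij by simp
    then show "\<not> distinct (vs[i := x, j := x])"
      using ij by (metis length_list_update nth_eq_iff_index_eq)
  qed
  have "?f (x + y) (x + y) = ?f x x + ?f x y + (?f y x + ?f y y)" for x y
    by (simp add: linear_add[OF lin1] linear_add[OF lin2])
  then have "?f x y = - ?f y x" for x y
    by (simp add: diag eq_neg_iff_add_eq_0)
  from this[of "vs ! j" "vs ! i"] show ?thesis by simp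
next
  case False
  then show ?thesis using kform_eq_0_length[OF \<alpha>] by simp
qed

lemma sign_comp_transpose:
  assumes "\<pi> permutes {..<n::nat}" "a \<noteq> b"
  shows "sign (\<pi> \<circ> Transposition.transpose a b) = - sign \<pi>"
  using assms by (simp add: sign_compose permutes_imp_permutation[OF finite_lessThan]
        permutation_swap_id sign_swap_id)

lemma kform_permute_list:
  assumes \<alpha>: "kform k \<alpha>" and "\<pi> permutes {..<length vs}"
  shows "\<alpha> (permute_list \<pi> vs) = of_int (sign \<pi>) *\<^sub>R \<alpha> vs"
  using finite_lessThan assms(2)
proof (induction rule: permutes_rev_induct)
  case id
  then show ?case by simp
next
  case (swap a b p)
  let ?t = "Transposition.transpose a b"
  have t: "?t permutes {..<length vs}"
    using swap by (intro permutes_swap_id) auto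
  have "permute_list (p \<circ> ?t) vs = permute_list ?t (permute_list p vs)"
    by (rule permute_list_compose[OF t])
  also have "\<dots> = (permute_list p vs)[a := permute_list p vs ! b, b := permute_list p vs ! a]"
    using swap by (auto simp: list_eq_iff_nth_eq permute_list_nth[of ?t "permute_list p vs", simplified, OF t]
        nth_list_update Transposition.transpose_def)
  finally have "\<alpha> (permute_list (p \<circ> ?t) vs) = - \<alpha> (permute_list p vs)"
    using kform_swap[OF \<alpha>, of a "permute_list p vs" b] swap by simp
  moreover have "sign (p \<circ> ?t) = - sign p"
    using swap by (intro sign_comp_transpose)
  ultimately show ?case using swap by (simp only: of_int_minus scaleR_minus_left)
qed

lemma interior_apply: "interior v \<alpha> vs = \<alpha> (v # vs)"
  by (simp add: interior_def)

lemma kform_interior: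
  assumes "kform (Suc k) \<alpha>"
  shows "kform k (interior v \<alpha>)"
  unfolding kform_def
proof (intro conjI allI impI)
  fix vs :: "'a list" and i assume "length vs = k \<and> i < k"
  then show "linear (\<lambda>x. interior v \<alpha> (vs[i := x]))"
    using kform_linear[OF assms, of "v # vs" "Suc i"] by (simp add: interior_apply)
qed (auto simp: interior_apply kform_eq_0_length[OF assms] kform_eq_0_not_distinct[OF assms])

lemma interior_kform_0: "kform 0 \<alpha> \<Longrightarrow> interior v \<alpha> = 0"
  by (auto simp: fun_eq_iff interior_apply kform_eq_0_length)

lemma wedge_kform:
  assumes "kform p \<alpha>" "kform q \<beta>" "length vs = p + q"
  shows "(\<alpha> \<and>\<^sub>f \<beta>) vs = (1 / (fact p * fact q)) * (\<Sum>\<pi> | \<pi> permutes {..<p + q}.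
    of_int (sign \<pi>) * (\<alpha> (map (\<lambda>i. vs ! \<pi> i) [0..<p]) * \<beta> (map (\<lambda>i. vs ! \<pi> i) [p..<p + q])))"
proof -
  let ?s = "\<lambda>r. (1 / (fact r * fact (p + q - r))) *\<^sub>R (\<Sum>\<pi> | \<pi> permutes {..<p + q}.
    of_int (sign \<pi>) *\<^sub>R (\<alpha> (map (\<lambda>i. vs ! \<pi> i) [0..<r]) * \<beta> (map (\<lambda>i. vs ! \<pi> i) [r..<p + q])))"
  have "(\<alpha> \<and>\<^sub>f \<beta>) vs = (\<Sum>r\<le>p + q. ?s r)"
    by (simp only: wedge_with_def assms(3) Let_def)
  also have "\<dots> = (\<Sum>r\<in>{p}. ?s r)"
    by (rule sum.mono_neutral_right) (auto simp: kform_eq_0_length[OF assms(1)])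
  finally show ?thesis by simp
qed

lemma wedge_length_neq:
  assumes "kform p \<alpha>" "kform q \<beta>" "length vs \<noteq> p + q"
  shows "(\<alpha> \<and>\<^sub>f \<beta>) vs = 0"
proof -
  have "\<alpha> (map f [0..<r]) * \<beta> (map f [r..<length vs]) = 0" if "r \<le> length vs" for r f
    using that assms(3) kform_eq_0_length[OF assms(1), of "map f [0..<r]"]
      kform_eq_0_length[OF assms(2), of "map f [r..<length vs]"] by (cases "r = p") auto
  then show ?thesis
    unfolding wedge_with_def Let_def
    by (intro sum.neutral ballI) (simp only: atMost_iff scaleR_zero_right sum.neutral_const)
qed

lemma wedge_Nil:
  assumes "kform p \<alpha>" "kform q \<beta>"
  shows "(\<alpha> \<and>\<^sub>f \<beta>) [] = \<alpha> [] * \<beta> []"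
proof (cases "p + q = 0")
  case True
  then show ?thesis using wedge_kform[OF assms, of "[]"] by simp
next
  case False
  then show ?thesis
    using wedge_length_neq[OF assms, of "[]"] kform_eq_0_length[OF assms(1), of "[]"]
      kform_eq_0_length[OF assms(2), of "[]"] by (cases p) auto
qed

section \<open>Sums over permutations, sorted by the slot that receives the first vector\<close>

lemma sum_permutes_fixing_0:
  "(\<Sum>\<pi> | \<pi> permutes {..<Suc n} \<and> \<pi> 0 = 0. f \<pi>)
     = (\<Sum>\<rho> | \<rho> permutes {..<n}. f (map_permutation {..<n} Suc \<rho>))"
proof (rule sum.reindex_bij_witness
    [where i = "map_permutation {..<n} Suc" and j = "map_permutation {1..<Suc n} (\<lambda>x. x - 1)"])
  have bP: "bij_betw (\<lambda>x. x - 1) {1..<Suc n} {..<n}"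
    by (rule bij_betw_byWitness[where f' = Suc]) auto
  fix \<pi> assume "\<pi> \<in> {\<pi>. \<pi> permutes {..<Suc n} \<and> \<pi> 0 = 0}"
  then have \<pi>: "\<pi> permutes {1..<Suc n}"
    by (elim CollectE conjE permutes_superset) (auto simp: not_le)
  show "map_permutation {..<n} Suc (map_permutation {1..<Suc n} (\<lambda>x. x - 1) \<pi>) = \<pi>"
    by (rule map_permutation_compose_inv[OF bP \<pi>]) auto
  then show "f (map_permutation {..<n} Suc (map_permutation {1..<Suc n} (\<lambda>x. x - 1) \<pi>)) = f \<pi>"
    by simp
  show "map_permutation {1..<Suc n} (\<lambda>x. x - 1) \<pi> \<in> {\<rho>. \<rho> permutes {..<n}}"
    using map_permutation_permutes[OF bP \<pi>] by simp
next
  have bS: "bij_betw Suc {..<n} {1..<Suc n}"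
    by (auto simp: bij_betw_def image_Suc_lessThan)
  fix \<rho> assume "\<rho> \<in> {\<rho>. \<rho> permutes {..<n}}"
  then have \<rho>: "\<rho> permutes {..<n}" by simp
  show "map_permutation {1..<Suc n} (\<lambda>x. x - 1) (map_permutation {..<n} Suc \<rho>) = \<rho>"
    by (rule map_permutation_compose_inv[OF bS \<rho>]) auto
  have "map_permutation {..<n} Suc \<rho> permutes {1..<Suc n}"
    by (rule map_permutation_permutes[OF bS \<rho>])
  then have "map_permutation {..<n} Suc \<rho> permutes {..<Suc n}" "map_permutation {..<n} Suc \<rho> 0 = 0"
    by (auto intro: permutes_subset dest: permutes_not_in[of _ _ 0])
  then show "map_permutation {..<n} Suc \<rho> \<in> {\<pi>. \<pi> permutes {..<Suc n} \<and> \<pi> 0 = 0}"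
    by simp
qed

text \<open>Precomposition with the transposition (a b) exchanges the permutations sending a to 0
  with those sending b to 0. The factor c is 1 when both slots belong to the same form and -1 when
  the vector moves to an adjacent slot past an argument of the first form.\<close>

lemma sum_permutes_move:
  assumes "a < n" "b < n"
    and T: "\<And>\<pi>. \<pi> permutes {..<n} \<Longrightarrow> \<pi> b = 0 \<Longrightarrow> f (\<pi> \<circ> Transposition.transpose a b) = c * g \<pi>"
  shows "(\<Sum>\<pi> | \<pi> permutes {..<n} \<and> \<pi> a = 0. f \<pi>)
     = (c :: real) * (\<Sum>\<pi> | \<pi> permutes {..<n} \<and> \<pi> b = 0. g \<pi>)"
proof -
  have t: "Transposition.transpose a b permutes {..<n}"
    using assms by (intro permutes_swap_id) auto
  have "(\<Sum>\<pi> | \<pi> permutes {..<n} \<and> \<pi> a = 0. f \<pi>)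
      = (\<Sum>\<pi> | \<pi> permutes {..<n} \<and> \<pi> b = 0. f (\<pi> \<circ> Transposition.transpose a b))"
    by (rule sum.reindex_bij_witness[where i = "\<lambda>\<pi>. \<pi> \<circ> Transposition.transpose a b" and j = "\<lambda>\<pi>. \<pi> \<circ> Transposition.transpose a b"])
      (auto simp: permutes_compose[OF t] comp_assoc)
  also have "\<dots> = c * (\<Sum>\<pi> | \<pi> permutes {..<n} \<and> \<pi> b = 0. g \<pi>)"
    by (simp add: sum_distrib_left T)
  finally show ?thesis .
qed

text \<open>Slot m is filled by argument number \<pi> m, so \<pi> m = 0 says that the head of the
  argument list lands in slot m.\<close>

lemma sum_permutes_by_preimage:
  fixes f :: "(nat \<Rightarrow> nat) \<Rightarrow> real"
  shows "(\<Sum>\<pi> | \<pi> permutes {..<Suc n}. f \<pi>)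
     = (\<Sum>m<Suc n. \<Sum>\<pi> | \<pi> permutes {..<Suc n} \<and> \<pi> m = 0. f \<pi>)"
proof -
  let ?S = "{\<pi>. \<pi> permutes {..<Suc n}}"
  have "(\<Sum>\<pi>\<in>?S. f \<pi>) = (\<Sum>m<Suc n. sum f {\<pi> \<in> ?S. inv \<pi> 0 = m})"
  proof (rule sum.group[symmetric])
    show "(\<lambda>\<pi>. inv \<pi> 0) ` ?S \<subseteq> {..<Suc n}"
      using permutes_in_image[OF permutes_inv, of _ "{..<Suc n}" 0] by fastforce
  qed (auto simp: finite_permutations)
  also have "\<dots> = (\<Sum>m<Suc n. \<Sum>\<pi> | \<pi> permutes {..<Suc n} \<and> \<pi> m = 0. f \<pi>)"
  proof (intro sum.cong refl)
    fix m
    show "{\<pi> \<in> ?S. inv \<pi> 0 = m} = {\<pi>. \<pi> permutes {..<Suc n} \<and> \<pi> m = 0}"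
      using permutes_inv_eq by fastforce
  qed
  finally show ?thesis .
qed

lemma wedge_zero: "0 \<and>\<^sub>f \<beta> = 0" "\<alpha> \<and>\<^sub>f 0 = 0"
  by (simp_all add: fun_eq_iff wedge_with_def Let_def)

lemma wedge_add_left: "(\<alpha> + \<beta>) \<and>\<^sub>f \<gamma> = \<alpha> \<and>\<^sub>f \<gamma> + \<beta> \<and>\<^sub>f \<gamma>"
  by (simp add: fun_eq_iff wedge_with_def Let_def algebra_simps add_divide_distrib sum.distrib
      flip: scaleR_add_right)

lemma wedge_add_right: "\<alpha> \<and>\<^sub>f (\<beta> + \<gamma>) = \<alpha> \<and>\<^sub>f \<beta> + \<alpha> \<and>\<^sub>f \<gamma>"
  by (simp add: fun_eq_iff wedge_with_def Let_def algebra_simps add_divide_distrib sum.distrib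
      flip: scaleR_add_right)

lemma wedge_scaleR_left: "(c *\<^sub>R \<alpha>) \<and>\<^sub>f \<beta> = c *\<^sub>R (\<alpha> \<and>\<^sub>f \<beta>)"
  by (simp add: fun_eq_iff wedge_with_def Let_def scaleR_fun_def sum_distrib_left
      mult.assoc mult.left_commute)

lemma wedge_scaleR_right: "\<alpha> \<and>\<^sub>f (c *\<^sub>R \<beta>) = c *\<^sub>R (\<alpha> \<and>\<^sub>f \<beta>)"
  by (simp add: fun_eq_iff wedge_with_def Let_def scaleR_fun_def sum_distrib_left
      mult.assoc mult.left_commute)

text \<open>Group the permutations by the position of \<open>v\<close>. Within one block of arguments, all positions
  contribute equally by alternation; adjacent transpositions carry \<open>v\<close> past the \<open>p\<close> arguments of
  \<open>\<alpha>\<close> at the cost of \<open>(-1) ^ p\<close>.\<close>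

lemma wedge_Cons:
  assumes \<alpha>: "kform p \<alpha>" and \<beta>: "kform q \<beta>"
  shows "(\<alpha> \<and>\<^sub>f \<beta>) (v # vs) = (interior v \<alpha> \<and>\<^sub>f \<beta>) vs + (-1) ^ p * (\<alpha> \<and>\<^sub>f interior v \<beta>) vs"
proof (cases "p + q = Suc (length vs)")
  case False
  have "(interior v \<alpha> \<and>\<^sub>f \<beta>) vs = 0"
  proof (cases p)
    case 0
    then show ?thesis using interior_kform_0[of \<alpha> v] \<alpha> by (simp add: wedge_zero)
  next
    case (Suc p')
    then show ?thesis
      using wedge_length_neq[OF kform_interior \<beta>] \<alpha> False by auto
  qed
  moreover have "(\<alpha> \<and>\<^sub>f interior v \<beta>) vs = 0"
  proof (cases q)
    case 0
    then show ?thesis using interior_kform_0[of \<beta> v] \<beta> by (simp add: wedge_zero)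
  next
    case (Suc p')
    then show ?thesis
      using wedge_length_neq[OF \<alpha> kform_interior] \<beta> False by auto
  qed
  ultimately show ?thesis using wedge_length_neq[OF \<alpha> \<beta>] False by auto
next
  case N: True
  define n where "n = length vs"
  let ?w = "\<lambda>\<pi> i. (v # vs) ! \<pi> i"
  let ?T = "\<lambda>\<pi>. of_int (sign \<pi>) * (\<alpha> (map (?w \<pi>) [0..<p]) * \<beta> (map (?w \<pi>) [p..<Suc n]))"
  let ?S = "\<lambda>m. \<Sum>\<pi> | \<pi> permutes {..<Suc n} \<and> \<pi> m = 0. ?T \<pi>"
  let ?M = "map_permutation {..<n} Suc"
  have M0: "?M \<rho> 0 = 0" if "\<rho> permutes {..<n}" for \<rho>
    by (auto simp: map_permutation_def)
  have MS: "?M \<rho> (Suc i) = Suc (\<rho> i)" if "\<rho> permutes {..<n}" "i < n" for \<rho> i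
    using that by (intro map_permutation_apply) auto
  have Msign: "sign (?M \<rho>) = sign \<rho>" if "\<rho> permutes {..<n}" for \<rho>
    using that by (intro sign_map_permutation) auto
  have Mshift: "map (?w (?M \<rho>)) [Suc a..<Suc b] = map (\<lambda>i. vs ! \<rho> i) [a..<b]"
    if "\<rho> permutes {..<n}" "b \<le> n" for \<rho> a b
    unfolding map_Suc_upt[symmetric] map_map using that by (auto simp: MS)
  have expand: "(\<alpha> \<and>\<^sub>f \<beta>) (v # vs) = (1 / (fact p * fact q)) * (\<Sum>m<p + q. ?S m)"
    using wedge_kform[OF \<alpha> \<beta>, of "v # vs"] N sum_permutes_by_preimage[of ?T n]
    by (simp add: n_def)
  have swapT: "?T (\<pi> \<circ> Transposition.transpose a b) = ?T \<pi>"
    if \<pi>: "\<pi> permutes {..<Suc n}" and ab: "a < p \<and> b < p \<or> p \<le> a \<and> a < Suc n \<and> p \<le> b \<and> b < Suc n"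
    for \<pi> a b
  proof (cases "a = b")
    case False
    from ab show ?thesis
    proof
      assume ab: "a < p \<and> b < p"
      let ?l = "map (?w \<pi>) [0..<p]"
      have "map (?w (\<pi> \<circ> Transposition.transpose a b)) [0..<p] = ?l[a := ?l ! b, b := ?l ! a]"
        using ab by (auto simp: list_eq_iff_nth_eq nth_list_update Transposition.transpose_def)
      then have "\<alpha> (map (?w (\<pi> \<circ> Transposition.transpose a b)) [0..<p]) = - \<alpha> ?l"
        using kform_swap[OF \<alpha>, of a ?l b] ab False by simp
      moreover have "map (?w (\<pi> \<circ> Transposition.transpose a b)) [p..<Suc n] = map (?w \<pi>) [p..<Suc n]"
        using ab by (auto simp: Transposition.transpose_def)
      ultimately show ?thesis using sign_comp_transpose[OF \<pi> False] by (simp only: of_int_minus mult_minus_left mult_minus_right minus_minus)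
    next
      assume ab: "p \<le> a \<and> a < Suc n \<and> p \<le> b \<and> b < Suc n"
      let ?l = "map (?w \<pi>) [p..<Suc n]"
      have "map (?w (\<pi> \<circ> Transposition.transpose a b)) [p..<Suc n] = ?l[a - p := ?l ! (b - p), b - p := ?l ! (a - p)]"
        using ab by (auto simp: list_eq_iff_nth_eq nth_list_update Transposition.transpose_def simp del: upt_Suc)
      then have "\<beta> (map (?w (\<pi> \<circ> Transposition.transpose a b)) [p..<Suc n]) = - \<beta> ?l"
        by (simp only:) (rule kform_swap[OF \<beta>]; use ab False in \<open>simp del: upt_Suc\<close>; linarith?)
      moreover have "map (?w (\<pi> \<circ> Transposition.transpose a b)) [0..<p] = map (?w \<pi>) [0..<p]"
        using ab by (auto simp: Transposition.transpose_def)
      ultimately show ?thesis using sign_comp_transpose[OF \<pi> False] by (simp only: of_int_minus mult_minus_left mult_minus_right minus_minus)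
    qed
  qed simp
  have first: "?S m = ?S 0" if "m < p" for m
    using sum_permutes_move[of m "Suc n" 0 ?T 1 ?T] swapT[of _ m 0] that N by (simp add: n_def)
  have second: "?S m = ?S p" if "p \<le> m" "m < p + q" for m
    using sum_permutes_move[of m "Suc n" p ?T 1 ?T] swapT[of _ m p] that N by (simp add: n_def)
  have "(\<Sum>m<p + q. ?S m) = (\<Sum>m<p. ?S m) + (\<Sum>m\<in>{p..<p + q}. ?S m)"
    by (subst sum.union_disjoint[symmetric]) (auto intro!: sum.cong)
  also have "(\<Sum>m<p. ?S m) = of_nat p * ?S 0"
    by (subst sum.cong[OF refl first]) (simp_all only: lessThan_iff sum_constant card_lessThan)
  also have "(\<Sum>m\<in>{p..<p + q}. ?S m) = of_nat q * ?S p"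
    by (subst sum.cong[OF refl second])
      (simp_all only: atLeastLessThan_iff sum_constant card_atLeastLessThan add_diff_cancel_left')
  finally have split: "(\<alpha> \<and>\<^sub>f \<beta>) (v # vs)
    = (1 / (fact p * fact q)) * (of_nat p * ?S 0) + (1 / (fact p * fact q)) * (of_nat q * ?S p)"
    by (simp only: expand distrib_left)
  have A: "(1 / (fact p * fact q)) * (of_nat p * ?S 0) = (interior v \<alpha> \<and>\<^sub>f \<beta>) vs"
  proof (cases p)
    case 0
    then show ?thesis using interior_kform_0[of \<alpha> v] \<alpha> by (simp add: wedge_zero)
  next
    case (Suc p')
    have n: "n = p' + q" using N Suc by (simp add: n_def)
    have "?T (?M \<rho>) = of_int (sign \<rho>) * (interior v \<alpha> (map (\<lambda>i. vs ! \<rho> i) [0..<p'])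
        * \<beta> (map (\<lambda>i. vs ! \<rho> i) [p'..<n]))" if "\<rho> permutes {..<n}" for \<rho>
    proof -
      have "[0..<p] = 0 # [Suc 0..<Suc p']" by (simp add: Suc upt_conv_Cons del: upt_Suc)
      then have "map (?w (?M \<rho>)) [0..<p] = v # map (\<lambda>i. vs ! \<rho> i) [0..<p']"
        using Mshift[OF that, of p' 0] M0[OF that] n by (simp del: upt_Suc)
      then show ?thesis
        using Mshift[OF that, of n p'] Msign[OF that] Suc by (simp add: interior_apply del: upt_Suc)
    qed
    then have "?S 0 = (\<Sum>\<rho> | \<rho> permutes {..<n}. of_int (sign \<rho>)
        * (interior v \<alpha> (map (\<lambda>i. vs ! \<rho> i) [0..<p']) * \<beta> (map (\<lambda>i. vs ! \<rho> i) [p'..<n])))"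
      by (subst sum_permutes_fixing_0) (auto intro!: sum.cong simp del: upt_Suc)
    moreover have "1 / (fact p * fact q) * (of_nat p * x) = 1 / (fact p' * fact q) * x" for x :: real
      unfolding Suc fact_Suc by (simp add: field_simps del: of_nat_Suc)
    ultimately show ?thesis
      using wedge_kform[OF kform_interior \<beta>, of p' \<alpha> vs v] \<alpha> n
      by (simp only: Suc n_def[symmetric])
  qed
  have B: "(1 / (fact p * fact q)) * (of_nat q * ?S p) = (-1) ^ p * (\<alpha> \<and>\<^sub>f interior v \<beta>) vs"
  proof (cases q)
    case 0
    then show ?thesis using interior_kform_0[of \<beta> v] \<beta> by (simp add: wedge_zero)
  next
    case (Suc q')
    have n: "n = p + q'" using N Suc by (simp add: n_def)
    \<comment> \<open>In \<open>?R k\<close> the vector v sits in slot k: the other slots among 0,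
      ..., p feed \<alpha> and the later ones feed the contracted \<beta>. So \<open>?R p\<close> is
      the original summand, and \<open>?R 0\<close> has v pulled to the front.\<close>
    let ?R = "\<lambda>k \<pi>. of_int (sign \<pi>) * (\<alpha> (map (?w \<pi>) ([0..<k] @ [Suc k..<Suc p]))
        * interior v \<beta> (map (?w \<pi>) [Suc p..<Suc n]))"
    let ?U = "\<lambda>k. \<Sum>\<pi> | \<pi> permutes {..<Suc n} \<and> \<pi> k = 0. ?R k \<pi>"
    have "?S p = ?U p"
    proof (rule sum.cong[OF refl])
      fix \<pi> assume "\<pi> \<in> {\<pi>. \<pi> permutes {..<Suc n} \<and> \<pi> p = 0}"
      moreover have "[p..<Suc n] = p # [Suc p..<Suc n]"
        using n by (simp add: upt_conv_Cons del: upt_Suc)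
      ultimately show "?T \<pi> = ?R p \<pi>" by (simp add: interior_apply del: upt_Suc)
    qed
    also have "?U k = (-1) ^ k * ?U 0" if "k \<le> p" for k
      using that
    proof (induction k)
      case (Suc k)
      have "?U (Suc k) = (-1) * ?U k"
      proof (rule sum_permutes_move)
        fix \<pi> assume \<pi>: "\<pi> permutes {..<Suc n}"
        have 1: "[0..<Suc k] = [0..<k] @ [k]" by simp
        have 2: "[Suc k..<Suc p] = Suc k # [Suc (Suc k)..<Suc p]"
          using Suc.prems by (intro upt_conv_Cons) simp
        have "map (?w (\<pi> \<circ> Transposition.transpose (Suc k) k)) ([0..<Suc k] @ [Suc (Suc k)..<Suc p])
          = map (?w \<pi>) ([0..<k] @ [Suc k..<Suc p])"
          unfolding 1 2 by (auto simp: Transposition.transpose_def simp del: upt_Suc)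
        moreover have "map (?w (\<pi> \<circ> Transposition.transpose (Suc k) k)) [Suc p..<Suc n] = map (?w \<pi>) [Suc p..<Suc n]"
          using Suc by (auto simp: Transposition.transpose_def simp del: upt_Suc)
        ultimately show "?R (Suc k) (\<pi> \<circ> Transposition.transpose (Suc k) k) = (-1) * ?R k \<pi>"
          using sign_comp_transpose[OF \<pi>, of "Suc k" k] by (simp only: of_int_minus mult_minus_left mult_1_left)
      qed (use Suc n in auto)
      then show ?case using Suc by simp
    qed simp
    then have "?U p = (-1) ^ p * ?U 0" by blast
    also have "?U 0 = (\<Sum>\<rho> | \<rho> permutes {..<n}. of_int (sign \<rho>)
        * (\<alpha> (map (\<lambda>i. vs ! \<rho> i) [0..<p]) * interior v \<beta> (map (\<lambda>i. vs ! \<rho> i) [p..<n])))"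
      unfolding sum_permutes_fixing_0
    proof (rule sum.cong[OF refl])
      fix \<rho> assume "\<rho> \<in> {\<rho>. \<rho> permutes {..<n}}"
      then have \<rho>: "\<rho> permutes {..<n}" by simp
      have "p \<le> n" using n by simp
      then show "?R 0 (?M \<rho>) = of_int (sign \<rho>)
        * (\<alpha> (map (\<lambda>i. vs ! \<rho> i) [0..<p]) * interior v \<beta> (map (\<lambda>i. vs ! \<rho> i) [p..<n]))"
        using Mshift[OF \<rho>, of p 0] Mshift[OF \<rho> order_refl, of p] Msign[OF \<rho>]
        by (simp del: upt_Suc)
    qed
    finally have "?S p = (-1) ^ p * (\<Sum>\<rho> | \<rho> permutes {..<n}. of_int (sign \<rho>)
        * (\<alpha> (map (\<lambda>i. vs ! \<rho> i) [0..<p]) * interior v \<beta> (map (\<lambda>i. vs ! \<rho> i) [p..<n])))" .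
    moreover have "1 / (fact p * fact q) * (of_nat q * (s * x)) = s * (1 / (fact p * fact q') * x)"
      for s x :: real
      unfolding Suc fact_Suc by (simp add: field_simps del: of_nat_Suc)
    ultimately show ?thesis
      using wedge_kform[OF \<alpha> kform_interior, of q' \<beta> vs v] \<beta> n
      by (simp only: Suc n_def[symmetric])
  qed
  show ?thesis using split A B by simp
qed

section \<open>Contraction and the algebra of the wedge product\<close>

lemma scaleR_fun_apply [simp]: "(r *\<^sub>R f) x = r *\<^sub>R f x"
  by (simp add: scaleR_fun_def)

lemma kform_interior_diff: "kform p \<alpha> \<Longrightarrow> kform (p - 1) (interior v \<alpha>)"
  by (cases p) (simp_all add: interior_kform_0 kform_interior)

lemma linear_interior:
  assumes "kform p \<alpha>"
  shows "linear (\<lambda>v. interior v \<alpha>)"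
proof (cases p)
  case 0
  with assms interior_kform_0 have "(\<lambda>v. interior v \<alpha>) = (\<lambda>v. 0)" by auto
  then show ?thesis by (simp add: linear_iff)
next
  case (Suc k)
  have "linear (\<lambda>x. \<alpha> (x # vs))" for vs
    using kform_Suc_linear assms Suc by blast
  then show ?thesis
    by (simp add: linear_iff fun_eq_iff interior_apply)
qed

lemma interior_wedge:
  assumes "kform p \<alpha>" "kform q \<beta>"
  shows "interior v (\<alpha> \<and>\<^sub>f \<beta>) = interior v \<alpha> \<and>\<^sub>f \<beta> + (-1) ^ p *\<^sub>R (\<alpha> \<and>\<^sub>f interior v \<beta>)"
  using wedge_Cons[OF assms] by (simp add: fun_eq_iff interior_apply)

lemma wedge_linear:
  assumes "kform p \<alpha>" "kform q \<beta>" "i < length vs"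
  shows "linear (\<lambda>x. (\<alpha> \<and>\<^sub>f \<beta>) (vs[i := x]))"
  using assms
proof (induction vs arbitrary: i \<alpha> \<beta> p q)
  case (Cons v vs)
  show ?case
  proof (cases i)
    case 0
    note A = linear_interior[OF Cons.prems(1)] and B = linear_interior[OF Cons.prems(2)]
    show ?thesis
      by (rule linearI) (simp_all add: 0 wedge_Cons[OF Cons.prems(1,2)] linear_add[OF A] linear_add[OF B]
          linear_scale[OF A] linear_scale[OF B] wedge_add_left wedge_add_right wedge_scaleR_left
          wedge_scaleR_right algebra_simps)
  next
    case (Suc j)
    then show ?thesis
      using Cons.IH[OF kform_interior_diff[OF Cons.prems(1)] Cons.prems(2), of j v]
        Cons.IH[OF Cons.prems(1) kform_interior_diff[OF Cons.prems(2)], of j v] Cons.prems(3)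
      by (auto simp: wedge_Cons[OF Cons.prems(1,2)] linear_iff algebra_simps)
  qed
qed simp

text \<open>Composing on the left with the transposition of two positions that hold equal vectors
  flips the sign of a permutation but changes no argument, so the sum equals its own
  negative.\<close>

lemma wedge_not_distinct:
  assumes "kform p \<alpha>" "kform q \<beta>" "\<not> distinct vs"
  shows "(\<alpha> \<and>\<^sub>f \<beta>) vs = 0"
proof (cases "length vs = p + q")
  case True
  let ?T = "\<lambda>\<pi>. of_int (sign \<pi>) * (\<alpha> (map (\<lambda>i. vs ! \<pi> i) [0..<p]) * \<beta> (map (\<lambda>i. vs ! \<pi> i) [p..<p + q]))"
  obtain i j where ij: "i < p + q" "j < p + q" "i \<noteq> j" "vs ! i = vs ! j"
    using assms(3) True by (auto simp: distinct_conv_nth)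
  let ?t = "Transposition.transpose i j"
  have nth: "vs ! ?t k = vs ! k" for k
    using ij by (simp add: Transposition.transpose_def)
  have t: "?t permutes {..<p + q}"
    using ij by (intro permutes_swap_id) auto
  have "sign (?t \<circ> \<pi>) = - sign \<pi>" if "\<pi> permutes {..<p + q}" for \<pi>
    using that ij by (simp add: sign_compose permutes_imp_permutation[OF finite_lessThan]
        permutation_swap_id sign_swap_id)
  then have neg: "?T (?t \<circ> \<pi>) = - ?T \<pi>" if "\<pi> permutes {..<p + q}" for \<pi>
    using that by (simp only: o_apply nth of_int_minus mult_minus_left)
  have "(\<Sum>\<pi> | \<pi> permutes {..<p + q}. ?T \<pi>) = - (\<Sum>\<pi> | \<pi> permutes {..<p + q}. ?T \<pi>)"
    unfolding sum_negf[symmetric]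
    by (subst setum_permutations_compose_left[OF t], rule sum.cong[OF refl], rule neg) simp
  then have "(\<Sum>\<pi> | \<pi> permutes {..<p + q}. ?T \<pi>) = 0" by linarith
  then show ?thesis by (simp only: wedge_kform[OF assms(1,2) True] mult_zero_right)
qed (use wedge_length_neq assms in blast)

lemma kform_wedge [intro]:
  "kform p \<alpha> \<Longrightarrow> kform q \<beta> \<Longrightarrow> kform (p + q) (\<alpha> \<and>\<^sub>f \<beta>)"
  unfolding kform_def[of "p + q"] by (auto intro: wedge_length_neq wedge_linear wedge_not_distinct)

text \<open>Both sides obey the same Leibniz rule under contraction, so induction on the argument
  list leaves only associativity of real multiplication on the empty list; no shuffle sums
  appear.\<close>

lemma wedge_assoc:
  assumes "kform p \<alpha>" "kform q \<beta>" "kform r \<gamma>"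
  shows "(\<alpha> \<and>\<^sub>f \<beta>) \<and>\<^sub>f \<gamma> = \<alpha> \<and>\<^sub>f \<beta> \<and>\<^sub>f \<gamma>"
proof
  fix vs
  show "((\<alpha> \<and>\<^sub>f \<beta>) \<and>\<^sub>f \<gamma>) vs = (\<alpha> \<and>\<^sub>f \<beta> \<and>\<^sub>f \<gamma>) vs"
    using assms
  proof (induction vs arbitrary: \<alpha> \<beta> \<gamma> p q r)
    case Nil
    then show ?case
      using wedge_Nil[OF kform_wedge[OF Nil(1,2)] Nil(3)] wedge_Nil[OF Nil(1) kform_wedge[OF Nil(2,3)]]
        wedge_Nil[OF Nil(1,2)] wedge_Nil[OF Nil(2,3)] by simp
  next
    case (Cons v vs)
    note a = Cons.prems(1) and b = Cons.prems(2) and c = Cons.prems(3)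
    show ?case
      using Cons.IH[OF kform_interior_diff[OF a] b c, of v] Cons.IH[OF a kform_interior_diff[OF b] c, of v]
        Cons.IH[OF a b kform_interior_diff[OF c], of v]
      by (simp add: wedge_Cons[OF kform_wedge[OF a b] c] wedge_Cons[OF a kform_wedge[OF b c]]
          interior_wedge[OF a b] interior_wedge[OF b c] wedge_add_left wedge_add_right
          wedge_scaleR_left wedge_scaleR_right algebra_simps power_add)
  qed
qed

section \<open>Products with a left factor of degree at most two\<close>

lemma wedge_0form:
  assumes "kform 0 \<alpha>" "kform q \<beta>"
  shows "(\<alpha> \<and>\<^sub>f \<beta>) vs = \<alpha> [] * \<beta> vs"
  using assms(2)
proof (induction vs arbitrary: q \<beta>)
  case Nil
  then show ?case using wedge_Nil[OF assms(1)] by blast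
next
  case (Cons v vs)
  have "(\<alpha> \<and>\<^sub>f interior v \<beta>) vs = \<alpha> [] * interior v \<beta> vs"
    by (rule Cons.IH[OF kform_interior_diff[OF Cons.prems]])
  then show ?case
    using interior_kform_0[OF assms(1), of v]
    by (simp add: wedge_Cons[OF assms(1) Cons.prems] wedge_zero interior_apply)
qed

lemma nths_compl_Cons_Suc: "nths (v # vs) (- {Suc j}) = v # nths vs (- {j})"
  by (simp add: nths_Cons Collect_neg_eq[symmetric] Compl_eq)

lemma nths_compl_Cons_0: "nths (v # vs) (- {0}) = vs"
  by (simp add: nths_Cons nths_all)

lemma nths_compl_pair_Cons_Suc: "nths (v # vs) (- {Suc i, Suc j}) = v # nths vs (- {i, j})"
  by (simp add: nths_Cons Compl_eq)

lemma nths_compl_pair_Cons_0: "nths (v # vs) (- {0, Suc j}) = nths vs (- {j})"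
  by (simp add: nths_Cons Compl_eq)

lemma wedge_1form:
  assumes "kform (Suc 0) \<theta>" "kform q \<beta>"
  shows "(\<theta> \<and>\<^sub>f \<beta>) vs = (\<Sum>j<length vs. (-1) ^ j * (\<theta> [vs ! j] * \<beta> (nths vs (- {j}))))"
  using assms(2)
proof (induction vs arbitrary: q \<beta>)
  case Nil
  then show ?case using wedge_Nil[OF assms(1) Nil] kform_eq_0_length[OF assms(1), of "[]"] by simp
next
  case (Cons v vs)
  have "(\<theta> \<and>\<^sub>f interior v \<beta>) vs
      = (\<Sum>j<length vs. (-1) ^ j * (\<theta> [vs ! j] * interior v \<beta> (nths vs (- {j}))))"
    by (rule Cons.IH[OF kform_interior_diff[OF Cons.prems]])
  moreover have "(interior v \<theta> \<and>\<^sub>f \<beta>) vs = interior v \<theta> [] * \<beta> vs"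
    by (rule wedge_0form[OF kform_interior[OF assms(1)] Cons.prems])
  ultimately show ?case
    by (simp add: wedge_Cons[OF assms(1) Cons.prems] sum.lessThan_Suc_shift interior_apply
        nths_compl_Cons_Suc nths_compl_Cons_0 sum_negf[symmetric] del: sum.lessThan_Suc)
qed

text \<open>The summands have the index pairs and signs of \<open>ext_d\<close>, and the overall
  minus sign absorbs the one in (d\<alpha>)(X, Y) = - \<alpha> [X, Y]. This is how the differential
  becomes a sum of wedge products.\<close>

lemma wedge_2form:
  assumes "kform (Suc (Suc 0)) \<omega>" "kform q \<beta>"
  shows "(\<omega> \<and>\<^sub>f \<beta>) vs
    = - (\<Sum>j<length vs. \<Sum>i<j. (-1) ^ (i + j) * (\<omega> [vs ! i, vs ! j] * \<beta> (nths vs (- {i, j}))))"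
  using assms(2)
proof (induction vs arbitrary: q \<beta>)
  case Nil
  then show ?case using wedge_Nil[OF assms(1) Nil] kform_eq_0_length[OF assms(1), of "[]"] by simp
next
  case (Cons v vs)
  have "(\<omega> \<and>\<^sub>f interior v \<beta>) vs = - (\<Sum>j<length vs. \<Sum>i<j.
      (-1) ^ (i + j) * (\<omega> [vs ! i, vs ! j] * interior v \<beta> (nths vs (- {i, j}))))"
    by (rule Cons.IH[OF kform_interior_diff[OF Cons.prems]])
  moreover have "(interior v \<omega> \<and>\<^sub>f \<beta>) vs
      = (\<Sum>j<length vs. (-1) ^ j * (interior v \<omega> [vs ! j] * \<beta> (nths vs (- {j}))))"
    by (rule wedge_1form[OF kform_interior[OF assms(1)] Cons.prems])
  ultimately show ?case
    by (simp add: wedge_Cons[OF assms(1) Cons.prems] sum.lessThan_Suc_shift interior_apply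
        nths_compl_pair_Cons_Suc nths_compl_pair_Cons_0 sum_negf sum_subtractf
        del: sum.lessThan_Suc)
qed

text \<open>The empty product. The constant function 1 would not be a 0-form, since forms vanish on
  lists of the wrong length.\<close>

definition unit_form :: "'n list \<Rightarrow> real" where
  "unit_form = (\<lambda>vs. if vs = [] then 1 else 0)"

lemma kform_unit_form [simp]: "kform 0 unit_form"
  by (auto simp: kform_def unit_form_def)

lemma wedge_unit_left: "kform q \<beta> \<Longrightarrow> unit_form \<and>\<^sub>f \<beta> = \<beta>"
  using wedge_0form[OF kform_unit_form] by (fastforce simp: unit_form_def)

lemma wedge_unit_right:
  assumes "kform p \<alpha>"
  shows "\<alpha> \<and>\<^sub>f unit_form = \<alpha>"
proof
  fix vs show "(\<alpha> \<and>\<^sub>f unit_form) vs = \<alpha> vs"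
    using assms
  proof (induction vs arbitrary: p \<alpha>)
    case Nil
    then show ?case using wedge_Nil[OF Nil kform_unit_form] by (simp add: unit_form_def)
  next
    case (Cons v vs)
    have "(interior v \<alpha> \<and>\<^sub>f unit_form) vs = interior v \<alpha> vs"
      by (rule Cons.IH[OF kform_interior_diff[OF Cons.prems]])
    then show ?case
      by (simp add: wedge_Cons[OF Cons.prems kform_unit_form] interior_kform_0[OF kform_unit_form] wedge_zero interior_apply)
  qed
qed

text \<open>Switched off because the simplifier would otherwise expand sums of forms inside larger terms
  into pointwise sums, hiding them from the algebraic laws.\<close>

lemmas form_apply = plus_fun_apply zero_fun_apply minus_apply uminus_apply scaleR_fun_apply

declare form_apply [simp del]

section \<open>Monomials in a coframe\<close>

definition monomial :: "(nat \<Rightarrow> 'n list \<Rightarrow> real) \<Rightarrow> nat list \<Rightarrow> 'n list \<Rightarrow> real" where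
  "monomial e J = foldr (\<lambda>j \<alpha>. e j \<and>\<^sub>f \<alpha>) J unit_form"

text \<open>A pair \<open>(c, J)\<close> stands for \<open>c e\<^sup>J\<close>; the multi-index \<open>J\<close> need be neither sorted nor free of
  repetitions.\<close>

definition form_of :: "(nat \<Rightarrow> 'n list \<Rightarrow> real) \<Rightarrow> (real \<times> nat list) list \<Rightarrow> 'n list \<Rightarrow> real" where
  "form_of e cs = (\<Sum>(c, J)\<leftarrow>cs. c *\<^sub>R monomial e J)"

definition scale_terms :: "real \<Rightarrow> (real \<times> nat list) list \<Rightarrow> (real \<times> nat list) list" where
  "scale_terms c = map (\<lambda>(d, J). (c * d, J))"

definition wedge_terms ::
  "(real \<times> nat list) list \<Rightarrow> (real \<times> nat list) list \<Rightarrow> (real \<times> nat list) list" where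
  "wedge_terms cs ds = concat (map (\<lambda>(c, I). map (\<lambda>(d, J). (c * d, I @ J)) ds) cs)"

text \<open>The antiderivation rule along a word: passing a factor costs a sign. A repeated index
  yields several terms, whose cancellation is left to the coefficients.\<close>

fun interior_monomial :: "nat \<Rightarrow> nat list \<Rightarrow> (real \<times> nat list) list" where
  "interior_monomial i [] = []"
| "interior_monomial i (j # J) =
     (if i = j then [(1, J)] else []) @ map (\<lambda>(c, K). (- c, j # K)) (interior_monomial i J)"

definition interior_terms :: "nat \<Rightarrow> (real \<times> nat list) list \<Rightarrow> (real \<times> nat list) list" where
  "interior_terms i cs = concat (map (\<lambda>(c, J). scale_terms c (interior_monomial i J)) cs)"

definition ext_d_terms ::
  "nat \<Rightarrow> (nat \<Rightarrow> (real \<times> nat list) list) \<Rightarrow> (real \<times> nat list) list \<Rightarrow> (real \<times> nat list) list" where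
  "ext_d_terms n de cs = concat (map (\<lambda>i. wedge_terms (de i) (interior_terms i cs)) [1..<Suc n])"

text \<open>The value on the basis vectors with the given indices, obtained by contracting with one
  after the other; multi-indices are thus compared without sorting them or collecting like
  terms.\<close>

fun coefficient :: "(real \<times> nat list) list \<Rightarrow> nat list \<Rightarrow> real" where
  "coefficient cs [] = (\<Sum>(c, J)\<leftarrow>cs. if J = [] then c else 0)"
| "coefficient cs (i # is) = coefficient (interior_terms i cs) is"

definition homogeneous :: "nat \<Rightarrow> nat \<Rightarrow> (real \<times> nat list) list \<Rightarrow> bool" where
  "homogeneous n k cs \<longleftrightarrow> (\<forall>(c, J)\<in>set cs. length J = k \<and> set J \<subseteq> {1..n})"

lemma homogeneous_Nil [simp]: "homogeneous n k []"
  by (simp add: homogeneous_def)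

lemma homogeneous_Cons [simp]:
  "homogeneous n k ((c, J) # cs) \<longleftrightarrow> length J = k \<and> set J \<subseteq> {1..n} \<and> homogeneous n k cs"
  by (simp add: homogeneous_def)

lemma homogeneous_append [simp]:
  "homogeneous n k (cs @ ds) \<longleftrightarrow> homogeneous n k cs \<and> homogeneous n k ds"
  by (simp add: homogeneous_def ball_Un)

lemma homogeneous_scale_terms [simp]: "homogeneous n k (scale_terms c cs) \<longleftrightarrow> homogeneous n k cs"
  by (induction cs) (auto simp: scale_terms_def)

lemma homogeneous_wedge_terms [simp]:
  "homogeneous n p cs \<Longrightarrow> homogeneous n q ds \<Longrightarrow> homogeneous n (p + q) (wedge_terms cs ds)"
  by (auto simp: homogeneous_def wedge_terms_def Ball_def subset_iff)

lemma homogeneous_interior_monomial: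
  "set J \<subseteq> {1..n} \<Longrightarrow> homogeneous n (length J - 1) (interior_monomial i J)"
proof (induction J)
  case (Cons j J)
  have "homogeneous n (Suc k) (map (\<lambda>(c, K). (- c, j # K)) cs)" if "homogeneous n k cs" for k cs
    using that Cons.prems by (induction cs) auto
  from this[OF Cons.IH] Cons.prems show ?case
    by (cases J) auto
qed simp

lemma homogeneous_interior_terms [simp]:
  "homogeneous n k cs \<Longrightarrow> homogeneous n (k - 1) (interior_terms i cs)"
proof (induction cs)
  case (Cons a cs)
  then show ?case
    using homogeneous_interior_monomial[of "snd a"] by (cases a) (auto simp: interior_terms_def)
qed (simp add: interior_terms_def)

lemma sum_fun_apply: "(\<Sum>i\<in>I. f i) x = (\<Sum>i\<in>I. f i x)"
  by (induction I rule: infinite_finite_induct) (simp_all add: form_apply)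

lemma form_of_Nil [simp]: "form_of e [] = 0"
  by (simp add: form_of_def)

lemma form_of_Cons [simp]: "form_of e ((c, J) # cs) = c *\<^sub>R monomial e J + form_of e cs"
  by (simp add: form_of_def)

lemma form_of_append [simp]: "form_of e (cs @ ds) = form_of e cs + form_of e ds"
  by (simp add: form_of_def)

lemma form_of_scale_terms [simp]: "form_of e (scale_terms c cs) = c *\<^sub>R form_of e cs"
  by (induction cs) (auto simp: scale_terms_def fun_eq_iff form_apply algebra_simps)

lemma form_of_concat: "form_of e (concat (map f xs)) = (\<Sum>x\<leftarrow>xs. form_of e (f x))"
  by (induction xs) auto

lemma filter_in_subseqs: "filter P xs \<in> set (subseqs xs)"
  by (induction xs) (auto simp: Let_def)

lemma subseqs_upt_subset: "is \<in> set (subseqs [1..<Suc n]) \<Longrightarrow> set is \<subseteq> {1..n}"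
  using subseqs_powset[of "[1..<Suc n]"]
  by (metis PowD atLeastLessThanSuc_atLeastAtMost image_eqI set_upt)

section \<open>Symbolic calculus in a coframe with its dual frame\<close>

locale coframe =
  fixes n :: nat and e :: "nat \<Rightarrow> 'n::real_vector list \<Rightarrow> real" and b :: "nat \<Rightarrow> 'n"
  assumes kform_e: "i \<in> {1..n} \<Longrightarrow> kform 1 (e i)"
    and dual: "i \<in> {1..n} \<Longrightarrow> j \<in> {1..n} \<Longrightarrow> e i [b j] = (if i = j then 1 else 0)"
    and expand: "v = (\<Sum>i\<in>{1..n}. e i [v] *\<^sub>R b i)"
begin

lemma kform_monomial: "set J \<subseteq> {1..n} \<Longrightarrow> kform (length J) (monomial e J)"
proof (induction J)
  case (Cons j J)
  then show ?case
    using kform_wedge[OF kform_e, of j "length J" "monomial e J"] by (simp add: monomial_def)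
qed (simp add: monomial_def)

lemma kform_form_of: "homogeneous n k cs \<Longrightarrow> kform k (form_of e cs)"
proof (induction cs)
  case (Cons a cs)
  obtain c J where a: "a = (c, J)" by fastforce
  with Cons.prems have "kform k (monomial e J)"
    using kform_monomial by auto
  with Cons show ?case
    unfolding a form_of_Cons by (intro kform_add kform_scaleR) auto
qed simp

lemma monomial_wedge_monomial:
  assumes "set I \<subseteq> {1..n}" "set J \<subseteq> {1..n}"
  shows "monomial e I \<and>\<^sub>f monomial e J = monomial e (I @ J)"
  using assms(1)
proof (induction I)
  case Nil
  then show ?case using wedge_unit_left[OF kform_monomial[OF assms(2)]] by (simp add: monomial_def)
next
  case (Cons i I)
  have "(e i \<and>\<^sub>f monomial e I) \<and>\<^sub>f monomial e J = e i \<and>\<^sub>f monomial e I \<and>\<^sub>f monomial e J"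
    using Cons.prems by (intro wedge_assoc[OF kform_e kform_monomial kform_monomial[OF assms(2)]]) auto
  then show ?case using Cons by (simp add: monomial_def)
qed

lemma e_eq_monomial: "i \<in> {1..n} \<Longrightarrow> e i = monomial e [i]"
  using wedge_unit_right[OF kform_e] by (simp add: monomial_def)

lemma form_of_wedge_form_of:
  assumes "homogeneous n p cs" "homogeneous n q ds"
  shows "form_of e cs \<and>\<^sub>f form_of e ds = form_of e (wedge_terms cs ds)"
  using assms(1)
proof (induction cs)
  case Nil
  show ?case by (simp only: wedge_terms_def wedge_zero list.map concat.simps form_of_Nil)
next
  case (Cons a cs)
  obtain c I where a: "a = (c, I)" by fastforce
  have "monomial e I \<and>\<^sub>f form_of e ds = form_of e (map (\<lambda>(d, J). (d, I @ J)) ds)"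
    using assms(2)
  proof (induction ds)
    case (Cons x ds)
    then show ?case
      using Cons.prems \<open>homogeneous n p (a # cs)\<close> a
      by (cases x) (simp add: wedge_add_right wedge_scaleR_right monomial_wedge_monomial)
  qed (simp add: wedge_zero)
  moreover have "map (\<lambda>(d, J). (c * d, I @ J)) ds = scale_terms c (map (\<lambda>(d, J). (d, I @ J)) ds)"
    by (simp add: scale_terms_def case_prod_unfold)
  ultimately show ?case
    using Cons by (simp add: a wedge_add_left wedge_scaleR_left wedge_terms_def)
qed

lemma interior_form_of_monomial:
  assumes "i \<in> {1..n}" "set J \<subseteq> {1..n}"
  shows "interior (b i) (monomial e J) = form_of e (interior_monomial i J)"
  using assms(2)
proof (induction J)
  case Nil
  then show ?case using interior_kform_0[OF kform_unit_form] by (simp add: monomial_def)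
next
  case (Cons j J)
  have j: "j \<in> {1..n}" and J: "set J \<subseteq> {1..n}" using Cons.prems by auto
  have "form_of e (map (\<lambda>(c, K). (- c, j # K)) cs) = - (e j \<and>\<^sub>f form_of e cs)" for cs
    by (induction cs) (auto simp: wedge_zero wedge_add_right wedge_scaleR_right monomial_def)
  moreover have "interior (b i) (e j) = (if i = j then 1 else 0) *\<^sub>R unit_form"
  proof
    fix vs show "interior (b i) (e j) vs = ((if i = j then 1 else 0) *\<^sub>R unit_form) vs"
      using dual[OF j assms(1)] kform_eq_0_length[OF kform_e[OF j], of "b i # vs"]
      by (cases "vs = []") (auto simp: form_apply interior_apply unit_form_def)
  qed
  moreover have "monomial e (j # J) = e j \<and>\<^sub>f monomial e J"
    by (simp add: monomial_def)
  ultimately show ?case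
    using Cons.IH[OF J] wedge_unit_left[OF kform_monomial[OF J]]
    by (simp add: interior_wedge[OF kform_e[OF j] kform_monomial[OF J]] wedge_scaleR_left wedge_zero)
qed

lemma interior_form_of:
  assumes "i \<in> {1..n}" "homogeneous n k cs"
  shows "interior (b i) (form_of e cs) = form_of e (interior_terms i cs)"
  using assms(2)
proof (induction cs)
  case Nil
  then show ?case by (simp add: fun_eq_iff form_apply interior_apply interior_terms_def)
next
  case (Cons a cs)
  obtain c J where a: "a = (c, J)" by fastforce
  have "interior (b i) (form_of e (a # cs))
      = c *\<^sub>R interior (b i) (monomial e J) + interior (b i) (form_of e cs)"
    by (simp add: a fun_eq_iff form_apply interior_apply)
  then show ?case
    using Cons interior_form_of_monomial[OF assms(1), of J]
    by (simp add: a interior_terms_def)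
qed

lemma form_of_apply:
  assumes "set is \<subseteq> {1..n}" "homogeneous n k cs"
  shows "form_of e cs (map b is) = coefficient cs is"
  using assms
proof (induction "is" arbitrary: cs k)
  case Nil
  have "monomial e J [] = (if J = [] then 1 else 0)" if "set J \<subseteq> {1..n}" for J
    using kform_eq_0_length[OF kform_monomial[OF that], of "[]"] by (simp add: monomial_def unit_form_def)
  with Nil(2) show ?case
    by (induction cs) (auto simp: form_apply)
next
  case (Cons i "is")
  have "form_of e cs (map b (i # is)) = interior (b i) (form_of e cs) (map b is)"
    by (simp add: interior_apply)
  also have "\<dots> = form_of e (interior_terms i cs) (map b is)"
    using interior_form_of Cons.prems by simp
  also have "\<dots> = coefficient cs (i # is)"
    using Cons.IH[OF _ homogeneous_interior_terms[OF Cons.prems(2)]] Cons.prems(1) by simp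
  finally show ?case .
qed

lemma linear_expand:
  assumes "linear f"
  shows "f v = (\<Sum>i\<in>{1..n}. e i [v] *\<^sub>R f (b i))"
  by (subst expand[of v]) (simp add: linear_sum[OF assms] linear_scale[OF assms])

lemma kform_eq_0I:
  assumes "kform k \<alpha>" and "\<And>is. length is = k \<Longrightarrow> set is \<subseteq> {1..n} \<Longrightarrow> \<alpha> (map b is) = 0"
  shows "\<alpha> vs = 0"
  using assms
proof (induction vs arbitrary: k \<alpha>)
  case Nil
  then show ?case using kform_eq_0_length[OF Nil(1), of "[]"] by force
next
  case (Cons v vs)
  show ?case
  proof (cases k)
    case 0
    then show ?thesis using kform_eq_0_length[OF Cons.prems(1)] by simp
  next
    case (Suc k')
    have "interior (b i) \<alpha> vs = 0" if "i \<in> {1..n}" for i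
    proof (rule Cons.IH)
      show "kform k' (interior (b i) \<alpha>)"
        using Cons.prems(1) Suc by (simp add: kform_interior)
      show "interior (b i) \<alpha> (map b is) = 0" if "length is = k'" "set is \<subseteq> {1..n}" for "is"
        using Cons.prems(2)[of "i # is"] that \<open>i \<in> {1..n}\<close> Suc by (simp add: interior_apply)
    qed
    then show ?thesis
      using linear_expand[OF kform_Suc_linear[of k' \<alpha> vs], of v] Cons.prems(1) Suc
      by (simp add: interior_apply)
  qed
qed

text \<open>Repeated indices give 0 and reordering only costs a sign, so increasing index lists
  decide. They are enumerated as the sublists of length k of 1, ..., n, a list that can be written
  out for a concrete n.\<close>

lemma kform_eqI:
  assumes "kform k \<alpha>" "kform k \<beta>"
    and "\<forall>is\<in>set (filter (\<lambda>J. length J = k) (subseqs [1..<Suc n])). \<alpha> (map b is) = \<beta> (map b is)"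
  shows "\<alpha> = \<beta>"
proof
  fix vs
  have \<gamma>: "kform k (\<alpha> - \<beta>)"
    using assms by auto
  have "(\<alpha> - \<beta>) (map b is) = 0" if "is": "length is = k" "set is \<subseteq> {1..n}" for "is"
  proof (cases "distinct is")
    case True
    have "filter (\<lambda>i. i \<in> set is) [1..<Suc n] = sort is"
      using True "is" by (intro sorted_distinct_set_unique sorted_wrt_filter) (auto simp del: upt_Suc)
    then have "sort is \<in> set (filter (\<lambda>J. length J = k) (subseqs [1..<Suc n]))"
      using filter_in_subseqs[of "\<lambda>i. i \<in> set is" "[1..<Suc n]"] "is" by (simp del: upt_Suc)
    then have 0: "(\<alpha> - \<beta>) (map b (sort is)) = 0"
      using assms(3) by (simp add: form_apply del: upt_Suc)
    obtain p where p: "p permutes {..<length (sort is)}" "permute_list p (sort is) = is"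
      by (rule mset_eq_permutation[of "is" "sort is"]) auto
    then have "map b is = permute_list p (map b (sort is))"
      by (simp add: permute_list_map)
    then show ?thesis
      using kform_permute_list[OF \<gamma>, of p "map b (sort is)"] p 0 by simp
  next
    case False
    then have "\<not> distinct (map b is)"
      by (simp add: distinct_map)
    then show ?thesis
      by (rule kform_eq_0_not_distinct[OF \<gamma>])
  qed
  then have "(\<alpha> - \<beta>) vs = 0"
    by (rule kform_eq_0I[OF \<gamma>])
  then show "\<alpha> vs = \<beta> vs" by (simp add: form_apply)
qed

lemma form_of_eqI:
  assumes "homogeneous n k cs" "homogeneous n k ds"
    and "\<forall>is\<in>set (filter (\<lambda>J. length J = k) (subseqs [1..<Suc n])). coefficient cs is = coefficient ds is"
  shows "form_of e cs = form_of e ds"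
proof (rule kform_eqI)
  show "\<forall>is\<in>set (filter (\<lambda>J. length J = k) (subseqs [1..<Suc n])).
    form_of e cs (map b is) = form_of e ds (map b is)"
    using assms(3) form_of_apply[OF subseqs_upt_subset assms(1)] form_of_apply[OF subseqs_upt_subset assms(2)]
    by (auto simp del: upt_Suc)
qed (use kform_form_of assms in blast)+

text \<open>Evaluating both sides on basis vectors, the bracket expands as
  \<open>[v, w] = - \<Sum>i. (d e\<^sup>i)(v, w) b\<^sub>i\<close>.\<close>

lemma ext_d_expand:
  assumes \<alpha>: "kform k \<alpha>" and de: "\<And>i. i \<in> {1..n} \<Longrightarrow> kform 2 (ext_d br (e i))"
  shows "ext_d br \<alpha> = (\<Sum>i\<in>{1..n}. ext_d br (e i) \<and>\<^sub>f interior (b i) \<alpha>)"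
proof
  fix vs
  have de_apply: "ext_d br (e i) [v, w] = - e i [br v w]" for i v w
    by (simp add: ext_d_def lessThan_Suc numeral_2_eq_2 nths_Cons)
  have lin: "\<alpha> (x # ws) = (\<Sum>i\<in>{1..n}. e i [x] * \<alpha> (b i # ws))" for x ws
  proof (cases k)
    case 0
    then show ?thesis using kform_eq_0_length[OF \<alpha>] by simp
  next
    case (Suc k')
    then show ?thesis
      using linear_expand[OF kform_Suc_linear[of k' \<alpha> ws], of x] \<alpha> by simp
  qed
  have "(\<Sum>i\<in>{1..n}. ext_d br (e i) \<and>\<^sub>f interior (b i) \<alpha>) vs
      = (\<Sum>i\<in>{1..n}. (ext_d br (e i) \<and>\<^sub>f interior (b i) \<alpha>) vs)"
    by (rule sum_fun_apply)
  also have "\<dots> = (\<Sum>i\<in>{1..n}. \<Sum>m<length vs. \<Sum>l<m.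
      (-1) ^ (l + m) * (e i [br (vs ! l) (vs ! m)] * \<alpha> (b i # nths vs (- {l, m}))))"
    using wedge_2form[OF de[unfolded numeral_2_eq_2] kform_interior_diff[OF \<alpha>]]
    by (intro sum.cong refl) (simp add: de_apply sum_negf interior_apply)
  also have "\<dots> = (\<Sum>m<length vs. \<Sum>l<m. (-1) ^ (l + m) *
      (\<Sum>i\<in>{1..n}. e i [br (vs ! l) (vs ! m)] * \<alpha> (b i # nths vs (- {l, m}))))"
    by (subst sum.swap, rule sum.cong[OF refl], subst sum.swap) (simp add: sum_distrib_left)
  also have "\<dots> = ext_d br \<alpha> vs"
    unfolding ext_d_def by (simp only: lin[symmetric] real_scaleR_def)
  finally show "ext_d br \<alpha> vs = (\<Sum>i\<in>{1..n}. ext_d br (e i) \<and>\<^sub>f interior (b i) \<alpha>) vs" ..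
qed

lemma ext_d_form_of:
  assumes "homogeneous n k cs"
    and de: "\<And>i. i \<in> {1..n} \<Longrightarrow> ext_d br (e i) = form_of e (de i)"
    and hom: "\<And>i. i \<in> {1..n} \<Longrightarrow> homogeneous n 2 (de i)"
  shows "ext_d br (form_of e cs) = form_of e (ext_d_terms n de cs)"
proof -
  have "ext_d br (form_of e cs) = (\<Sum>i\<in>{1..n}. ext_d br (e i) \<and>\<^sub>f interior (b i) (form_of e cs))"
    using de hom kform_form_of by (intro ext_d_expand[OF kform_form_of[OF assms(1)]]) simp
  also have "\<dots> = (\<Sum>i\<in>{1..n}. form_of e (wedge_terms (de i) (interior_terms i cs)))"
    using de hom interior_form_of[OF _ assms(1)]
      form_of_wedge_form_of[OF _ homogeneous_interior_terms[OF assms(1)]]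
    by (intro sum.cong refl) fastforce
  also have "\<dots> = form_of e (ext_d_terms n de cs)"
    by (simp add: ext_d_terms_def form_of_concat sum_list_distinct_conv_sum_set
        atLeastLessThanSuc_atLeastAtMost del: upt_Suc)
  finally show ?thesis .
qed

end

section \<open>Dual bases and traces\<close>

text \<open>The exchange argument, phrased with a finite spanning set because the vector type itself
  is not assumed finite-dimensional: one more independent vector would outnumber T.\<close>

lemma spanning_if_card_ge:
  assumes "finite T" "independent S" "S \<subseteq> span T" "card T \<le> card S"
  shows "span T \<subseteq> span S"
proof
  fix v assume v: "v \<in> span T"
  show "v \<in> span S"
  proof (rule ccontr)
    assume "v \<notin> span S"
    moreover from this have "v \<notin> S" using span_base by blast
    ultimately have "independent (insert v S)" "card (insert v S) = Suc (card S)"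
      using assms(2) independent_span_bound[OF assms(1-3)] by (simp_all add: independent_insert)
    then show False
      using independent_span_bound[OF assms(1), of "insert v S"] v assms(3,4) by auto
  qed
qed

text \<open>A nonzero \<open>dim\<close> certifies a finite basis, because an infinite one has
  \<open>card\<close> 0.\<close>

lemma independent_card_dim_spanning:
  fixes S :: "'n::real_vector set"
  assumes "independent S" "card S = dim (UNIV :: 'n set)" "finite S" "S \<noteq> {}"
  shows "span S = UNIV"
proof -
  obtain B :: "'n set" where B: "independent B" "UNIV \<subseteq> span B" "card B = dim (UNIV :: 'n set)"
    by (rule basis_exists)
  have "card S \<noteq> 0" using assms(3,4) by simp
  then have "finite B" using B assms(2) card.infinite by force
  then show ?thesis
    using spanning_if_card_ge[of B S] B assms by auto
qed

text \<open>\<open>dual_basis\<close> speaks only about the dual space. The vectors b_j are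
  preimages of the unit vectors under the evaluation map sending v to all e_i(v); it is injective
  because 1-forms separate points, and then hits every unit vector by a dimension count.\<close>

lemma dual_basis_exists:
  fixes e :: "nat \<Rightarrow> 'n::real_vector list \<Rightarrow> real"
  assumes e: "dual_basis e n" and n: "dim (UNIV :: 'n set) = n" "n \<noteq> 0"
  obtains b where "coframe n e b"
proof -
  have kf: "kform 1 (e i)" if "i \<in> {1..n}" for i
    using e that span_base[of "e i" "e ` {1..n}"] unfolding dual_basis_def by auto
  have lin: "linear (\<lambda>x. e i [x])" if "i \<in> {1..n}" for i
    using kform_Suc_linear[of 0 "e i" "[]"] kf[OF that] by simp
  obtain B :: "'n set" where B: "independent B" "UNIV \<subseteq> span B" "card B = n"
    using basis_exists[of "UNIV :: 'n set"] n by metis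
  have finB: "finite B" using B n card.infinite by force
  have zero: "v = 0" if "\<And>i. i \<in> {1..n} \<Longrightarrow> e i [v] = 0" for v
  proof -
    have "\<alpha> [v] = 0" if "\<alpha> \<in> span (e ` {1..n})" for \<alpha>
      using that
    proof (induction rule: span_induct_alt)
      case (step c x y)
      then show ?case using \<open>\<And>i. i \<in> {1..n} \<Longrightarrow> e i [v] = 0\<close> by (auto simp: form_apply)
    qed (simp add: form_apply)
    then have all: "\<alpha> [v] = 0" if "kform 1 \<alpha>" for \<alpha> :: "'n list \<Rightarrow> real"
      using e that unfolding dual_basis_def by blast
    have "representation B v x = 0" for x
    proof -
      \<comment> \<open>A coordinate functional of the basis B; as a 1-form it lies in the span of
        the e_i and so vanishes at v.\<close>
      let ?\<alpha> = "\<lambda>vs. if length vs = 1 then representation B (hd vs) x else 0"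
      have "linear (\<lambda>y. representation B y x)"
        using B by (intro linearI) (simp_all add: representation_add representation_scale subset_eq)
      then have "kform 1 ?\<alpha>"
        by (auto simp: kform_def length_Suc_conv)
      from all[OF this] show ?thesis by simp
    qed
    then show ?thesis
      using sum_nonzero_representation_eq[of B v] B by auto
  qed
  \<comment> \<open>Coordinate vectors are functions on the naturals, cut off to 0 outside 1, ..., n
    so that the finitely many unit functions span a space containing the range.\<close>
  let ?E = "\<lambda>v i. if i \<in> {1..n} then e i [v] else 0"
  let ?\<delta> = "\<lambda>j i. if i = j then 1 else (0::real)"
  have linE: "linear ?E"
    by (rule linearI) (auto simp: fun_eq_iff form_apply linear_add[OF lin] linear_scale[OF lin])
  have injE: "inj ?E"
  proof (rule linear_injective_0[OF linE, THEN iffD2], intro allI impI)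
    fix v assume "?E v = 0"
    then have "?E v i = 0" for i using fun_cong[of "?E v" 0 i] by (simp only: zero_fun_apply)
    then show "v = 0" by (intro zero) metis
  qed
  have "span (?\<delta> ` {1..n}) \<subseteq> span (?E ` B)"
  proof (rule spanning_if_card_ge)
    show "independent (?E ` B)"
      using linear_independent_injective_image[OF linE B(1)] injE inj_on_subset by blast
    show "card (?\<delta> ` {1..n}) \<le> card (?E ` B)"
      using card_image_le[of "{1..n}" ?\<delta>] card_image[of ?E B] injE B(3) inj_on_subset by fastforce
    have "?E v = (\<Sum>j\<in>{1..n}. e j [v] *\<^sub>R ?\<delta> j)" for v
      by (auto simp: fun_eq_iff sum_fun_apply form_apply if_distrib[of "\<lambda>x. _ * x"] cong: if_cong)
    then have "?E v \<in> span (?\<delta> ` {1..n})" for v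
      by (metis (no_types, lifting) image_eqI span_base span_scale span_sum)
    then show "?E ` B \<subseteq> span (?\<delta> ` {1..n})" by blast
  qed simp
  also have "span (?E ` B) = ?E ` span B"
    by (rule linear_span_image[OF linE])
  finally have "?\<delta> j \<in> range ?E" if "j \<in> {1..n}" for j
    using that span_base[of "?\<delta> j" "?\<delta> ` {1..n}"] by blast
  then obtain b where b: "\<And>j. j \<in> {1..n} \<Longrightarrow> ?\<delta> j = ?E (b j)"
    unfolding image_iff by metis
  have dual: "e i [b j] = (if i = j then 1 else 0)" if "i \<in> {1..n}" "j \<in> {1..n}" for i j
    using fun_cong[OF b[OF that(2)], of i] that by (simp split: if_splits)
  have "coframe n e b"
  proof
    fix v
    have "v - (\<Sum>i\<in>{1..n}. e i [v] *\<^sub>R b i) = 0"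
    proof (rule zero)
      fix k assume k: "k \<in> {1..n}"
      have "(\<Sum>i\<in>{1..n}. e i [v] * e k [b i]) = (\<Sum>i\<in>{1..n}. if i = k then e k [v] else 0)"
        by (rule sum.cong) (use dual k in auto)
      then show "e k [v - (\<Sum>i\<in>{1..n}. e i [v] *\<^sub>R b i)] = 0"
        using k by (simp add: linear_diff[OF lin[OF k]] linear_sum[OF lin[OF k]] linear_scale[OF lin[OF k]])
    qed
    then show "v = (\<Sum>i\<in>{1..n}. e i [v] *\<^sub>R b i)" by simp
  qed (use kf dual in auto)
  then show ?thesis by (rule that)
qed

text \<open>The basis chosen in \<open>trace_on\<close> is unknown. Expanding its members along C
  and the images of C along it gives a double sum that can be read from either side, as in tr(PQ) =
  tr(QP).\<close>

lemma trace_on_eq: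
  assumes C: "independent C" "finite C" "span C = S" and f: "linear f" "f ` S \<subseteq> S"
  shows "trace_on S f = (\<Sum>c\<in>C. representation C (f c) c)"
proof -
  define B where "B = (SOME B. independent B \<and> span B = S)"
  have B: "independent B \<and> span B = S"
    unfolding B_def by (rule someI[of _ C]) (use C in simp)
  have finB: "finite B"
    using independent_span_bound[of C B] B C span_superset[of B] by auto
  have fS: "f v \<in> span C" "f v \<in> span B" if "v \<in> span B" for v
    using that f(2) B C(3) by auto
  have exp: "v = (\<Sum>c\<in>D. representation D v c *\<^sub>R c)" if "v \<in> span D" "independent D" "finite D" for v and D
    using sum_representation_eq[OF that(2,1,3)] by simp
  have rsum: "representation D (\<Sum>x\<in>X. u x *\<^sub>R w x) d = (\<Sum>x\<in>X. u x * representation D (w x) d)"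
    if "independent D" "\<And>x. x \<in> X \<Longrightarrow> w x \<in> span D" for D X u w d
    using that by (simp add: representation_sum span_scale representation_scale)
  have CB: "c \<in> span B" "f c \<in> span B" if "c \<in> C" for c
    using that B C span_base[of c C] fS by auto
  have BC: "x \<in> span C" "f x \<in> span C" if "x \<in> B" for x
    using that B C span_base[of x B] fS by auto
  have "trace_on S f = (\<Sum>x\<in>B. representation B (f x) x)"
    by (simp add: trace_on_def B_def Let_def)
  also have "\<dots> = (\<Sum>x\<in>B. \<Sum>c\<in>C. representation C x c * representation B (f c) x)"
  proof (rule sum.cong[OF refl])
    fix x assume x: "x \<in> B"
    have "f x = f (\<Sum>c\<in>C. representation C x c *\<^sub>R c)"
      using exp[OF BC(1)[OF x] C(1,2)] by simp
    also have "\<dots> = (\<Sum>c\<in>C. representation C x c *\<^sub>R f c)"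
      by (simp add: linear_sum[OF f(1)] linear_scale[OF f(1)])
    finally show "representation B (f x) x = (\<Sum>c\<in>C. representation C x c * representation B (f c) x)"
      using rsum[of B C f] B CB by simp
  qed
  also have "\<dots> = (\<Sum>c\<in>C. \<Sum>x\<in>B. representation B (f c) x * representation C x c)"
    by (subst sum.swap) (simp add: mult.commute)
  also have "\<dots> = (\<Sum>c\<in>C. representation C (f c) c)"
  proof (rule sum.cong[OF refl])
    fix c assume c: "c \<in> C"
    have "representation C (f c) c = representation C (\<Sum>x\<in>B. representation B (f c) x *\<^sub>R x) c"
      using exp[OF CB(2)[OF c] _ finB] B by simp
    also have "\<dots> = (\<Sum>x\<in>B. representation B (f c) x * representation C x c)"
      using rsum[of C B "\<lambda>x. x"] C BC by simp
    finally show "(\<Sum>x\<in>B. representation B (f c) x * representation C x c) = representation C (f c) c" ..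
  qed
  finally show ?thesis .
qed

section \<open>Orthonormal frames and the Hodge star\<close>

lemma kform_append:
  assumes "kform (k + length ws) \<alpha>"
  shows "kform k (\<lambda>vs. \<alpha> (vs @ ws))"
  unfolding kform_def
proof (intro conjI allI impI)
  fix vs :: "'a list" and i assume "length vs = k \<and> i < k"
  then show "linear (\<lambda>x. \<alpha> (vs[i := x] @ ws))"
    using kform_linear[OF assms, of "vs @ ws" i] by (simp add: list_update_append)
qed (auto simp: kform_eq_0_length[OF assms] kform_eq_0_not_distinct[OF assms])

text \<open>The permutation sign enters twice and squares to 1, so all orderings of the same vectors
  contribute equally to a sum of such products.\<close>

lemma kform_mult_permuted:
  fixes \<alpha> \<beta> :: "'n::real_vector list \<Rightarrow> real"
  assumes "kform k \<alpha>" "kform k \<beta>" "mset vs = mset ws"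
  shows "\<alpha> vs * \<beta> vs = \<alpha> ws * \<beta> ws"
proof -
  obtain p where p: "p permutes {..<length ws}" "permute_list p ws = vs"
    by (rule mset_eq_permutation[OF assms(3)])
  have "of_int (sign p) * of_int (sign p) = (1::real)"
    by (metis of_int_1 of_int_mult sign_idempotent)
  then show ?thesis
    using kform_permute_list[OF assms(1) p(1)] kform_permute_list[OF assms(2) p(1)] p(2)
    by (simp add: algebra_simps)
qed

lemma sum_lists_Suc:
  assumes "finite B"
  shows "(\<Sum>is | set is \<subseteq> B \<and> length is = Suc k. f is)
    = (\<Sum>x\<in>B. \<Sum>is | set is \<subseteq> B \<and> length is = k. f (x # is))"
proof -
  have "(\<Sum>x\<in>B. \<Sum>is | set is \<subseteq> B \<and> length is = k. f (x # is))
      = (\<Sum>(x, is)\<in>B \<times> {is. set is \<subseteq> B \<and> length is = k}. f (x # is))"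
    by (rule sum.cartesian_product)
  also have "\<dots> = (\<Sum>is | set is \<subseteq> B \<and> length is = Suc k. f is)"
    by (rule sum.reindex_bij_witness[where i = "\<lambda>is. (hd is, tl is)" and j = "\<lambda>(x, is). x # is"])
      (auto simp: length_Suc_conv)
  finally show ?thesis ..
qed

text \<open>The nonzero dimension keeps out infinite-dimensional spaces, where \<open>dim\<close> is
  0 and the empty list would count as an orthonormal frame.\<close>

locale inner_product_frame =
  fixes g :: "'n::real_vector \<Rightarrow> 'n \<Rightarrow> real"
  assumes g: "inner_product g" and dim_pos: "dim (UNIV :: 'n set) \<noteq> 0"
begin

lemma bilinear_g: "bilinear g" and g_sym: "g x y = g y x"
  using g by (auto simp: inner_product_def)

lemma linear_g: "linear (\<lambda>x. g x y)" "linear (g x)"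
  using bilinear_g by (auto simp: bilinear_def)

lemma frame_distinct:
  assumes "orthonormal_frame g bs"
  shows "distinct bs"
  using assms unfolding orthonormal_frame_def distinct_conv_nth by (metis zero_neq_one)

lemma frame_g:
  assumes "orthonormal_frame g bs" "x \<in> set bs" "y \<in> set bs"
  shows "g x y = (if x = y then 1 else 0)"
  using assms frame_distinct[OF assms(1)] nth_eq_iff_index_eq[of bs]
  unfolding orthonormal_frame_def in_set_conv_nth by auto

lemma frame_expand:
  assumes bs: "orthonormal_frame g bs"
  shows "v = (\<Sum>x\<in>set bs. g v x *\<^sub>R x)"
proof -
  have coeff: "g (\<Sum>x\<in>set bs. u x *\<^sub>R x) y = u y" if "y \<in> set bs" for u y
  proof -
    have "g (\<Sum>x\<in>set bs. u x *\<^sub>R x) y = (\<Sum>x\<in>set bs. if x = y then u y else 0)"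
      unfolding linear_sum[OF linear_g(1)] linear_scale[OF linear_g(1)]
      by (rule sum.cong) (use frame_g[OF bs] that in auto)
    then show ?thesis using that by simp
  qed
  have "independent (set bs)"
  proof
    assume "dependent (set bs)"
    then obtain u where u: "\<exists>x\<in>set bs. u x \<noteq> 0" "(\<Sum>x\<in>set bs. u x *\<^sub>R x) = 0"
      by (auto simp: dependent_finite)
    then show False
      using coeff[of _ u] linear_0[OF linear_g(1)] by fastforce
  qed
  moreover have "card (set bs) = dim (UNIV :: 'n set)"
    using bs distinct_card[OF frame_distinct[OF bs]] by (simp add: orthonormal_frame_def)
  ultimately have "span (set bs) = UNIV"
    using dim_pos by (intro independent_card_dim_spanning) auto
  then obtain u where "v = (\<Sum>x\<in>set bs. u x *\<^sub>R x)"
    using span_finite[of "set bs"] by auto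
  then show ?thesis
    using coeff[of _ u] by (metis (no_types, lifting) sum.cong)
qed

text \<open>Both sides are the g-trace of G: expanding in the second frame and applying Parseval in
  the first leaves g(y, z) G(y, z), of which only the diagonal survives.\<close>

lemma sum_frame_independent:
  fixes G :: "'n \<Rightarrow> 'n \<Rightarrow> real"
  assumes bs: "orthonormal_frame g bs" and cs: "orthonormal_frame g cs" and G: "bilinear G"
  shows "(\<Sum>x\<in>set bs. G x x) = (\<Sum>y\<in>set cs. G y y)"
proof -
  have lin: "linear (\<lambda>x. G x y)" "linear (G x)" for x y
    using G by (auto simp: bilinear_def)
  have expG: "G x x = (\<Sum>y\<in>set cs. \<Sum>z\<in>set cs. g x y * g x z * G y z)" for x
  proof -
    have "G x x = G (\<Sum>y\<in>set cs. g x y *\<^sub>R y) (\<Sum>z\<in>set cs. g x z *\<^sub>R z)"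
      using frame_expand[OF cs, of x] by simp
    also have "\<dots> = (\<Sum>y\<in>set cs. g x y * G y (\<Sum>z\<in>set cs. g x z *\<^sub>R z))"
      by (simp add: linear_sum[OF lin(1)] linear_scale[OF lin(1)])
    finally show ?thesis
      by (simp add: linear_sum[OF lin(2)] linear_scale[OF lin(2)] sum_distrib_left mult.assoc)
  qed
  have parseval: "(\<Sum>x\<in>set bs. g x y * g x z) = g y z" for y z
  proof -
    have "g y z = g (\<Sum>x\<in>set bs. g y x *\<^sub>R x) z"
      using frame_expand[OF bs, of y] by simp
    then show ?thesis
      by (simp add: linear_sum[OF linear_g(1)] linear_scale[OF linear_g(1)] g_sym[of y])
  qed
  have "(\<Sum>x\<in>set bs. G x x) = (\<Sum>y\<in>set cs. \<Sum>z\<in>set cs. (\<Sum>x\<in>set bs. g x y * g x z) * G y z)"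
    unfolding expG by (subst sum.swap, rule sum.cong[OF refl], subst sum.swap) (simp add: sum_distrib_right)
  also have "\<dots> = (\<Sum>y\<in>set cs. \<Sum>z\<in>set cs. if z = y then G y y else 0)"
    unfolding parseval using frame_g[OF cs] by (intro sum.cong refl) auto
  finally show ?thesis by simp
qed

text \<open>Frames are exchanged one slot at a time, the tail by induction and the head as the trace
  of a bilinear form. This is what makes the arbitrary choice of frame in \<open>hodge\<close>
  harmless.\<close>

lemma sum_lists_frame_independent:
  fixes P Q :: "'n list \<Rightarrow> real"
  assumes bs: "orthonormal_frame g bs" and cs: "orthonormal_frame g cs"
    and "kform k P" "kform k Q"
  shows "(\<Sum>is | set is \<subseteq> set bs \<and> length is = k. P is * Q is)
    = (\<Sum>is | set is \<subseteq> set cs \<and> length is = k. P is * Q is)"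
  using assms(3,4)
proof (induction k arbitrary: P Q)
  case 0
  have "{is. set is \<subseteq> B \<and> length is = 0} = {[]}" for B :: "'n set" by auto
  then show ?case by simp
next
  case (Suc k)
  have "(\<Sum>is | set is \<subseteq> set bs \<and> length is = Suc k. P is * Q is)
      = (\<Sum>x\<in>set bs. \<Sum>is | set is \<subseteq> set bs \<and> length is = k. P (x # is) * Q (x # is))"
    by (rule sum_lists_Suc) simp
  also have "\<dots> = (\<Sum>x\<in>set bs. \<Sum>is | set is \<subseteq> set cs \<and> length is = k. P (x # is) * Q (x # is))"
    using Suc.IH[OF kform_interior[OF Suc.prems(1)] kform_interior[OF Suc.prems(2)]]
    by (simp add: interior_apply)
  also have "\<dots> = (\<Sum>is | set is \<subseteq> set cs \<and> length is = k. \<Sum>x\<in>set bs. P (x # is) * Q (x # is))"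
    by (rule sum.swap)
  also have "\<dots> = (\<Sum>is | set is \<subseteq> set cs \<and> length is = k. \<Sum>x\<in>set cs. P (x # is) * Q (x # is))"
  proof (rule sum.cong[OF refl])
    fix "is" :: "'n list"
    have "linear (\<lambda>x. P (x # is))" "linear (\<lambda>x. Q (x # is))"
      using kform_Suc_linear Suc.prems by blast+
    then have "bilinear (\<lambda>x y. P (x # is) * Q (y # is))"
      by (auto simp: bilinear_def linear_iff algebra_simps)
    then show "(\<Sum>x\<in>set bs. P (x # is) * Q (x # is)) = (\<Sum>x\<in>set cs. P (x # is) * Q (x # is))"
      by (rule sum_frame_independent[OF bs cs])
  qed
  also have "\<dots> = (\<Sum>x\<in>set cs. \<Sum>is | set is \<subseteq> set cs \<and> length is = k. P (x # is) * Q (x # is))"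
    by (rule sum.swap)
  also have "\<dots> = (\<Sum>is | set is \<subseteq> set cs \<and> length is = Suc k. P is * Q is)"
    by (rule sum_lists_Suc[symmetric]) simp
  finally show ?case .
qed

text \<open>Together with frame independence this shows that the square of vol(bs) is the same for
  every orthonormal frame, so that normalising in a single frame suffices.\<close>

lemma sum_lists_frame_top_degree:
  assumes bs: "orthonormal_frame g bs" and vol: "kform (dim (UNIV :: 'n set)) vol"
  shows "(\<Sum>is | set is \<subseteq> set bs \<and> length is = dim (UNIV :: 'n set). vol is * vol is)
    = fact (dim (UNIV :: 'n set)) * (vol bs * vol bs :: real)"
proof -
  let ?N = "dim (UNIV :: 'n set)"
  have len: "length bs = ?N" and card: "card (set bs) = ?N"
    using bs distinct_card[OF frame_distinct[OF bs]] by (auto simp: orthonormal_frame_def)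
  have "(\<Sum>is | set is \<subseteq> set bs \<and> length is = ?N. vol is * vol is)
      = (\<Sum>is\<in>permutations_of_set (set bs). vol is * vol is)"
  proof (rule sum.mono_neutral_right)
    show "finite {is. set is \<subseteq> set bs \<and> length is = ?N}"
      by (rule finite_lists_length_eq) simp
    show "permutations_of_set (set bs) \<subseteq> {is. set is \<subseteq> set bs \<and> length is = ?N}"
      using card by (auto simp: permutations_of_set_def distinct_card[symmetric])
    show "\<forall>is\<in>{is. set is \<subseteq> set bs \<and> length is = ?N} - permutations_of_set (set bs). vol is * vol is = 0"
    proof
      fix "is" assume "is": "is \<in> {is. set is \<subseteq> set bs \<and> length is = ?N} - permutations_of_set (set bs)"
      have "\<not> distinct is"
      proof
        assume d: "distinct is"
        then have "card (set is) = card (set bs)" using "is" card distinct_card by force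
        then have "set is = set bs" using "is" by (intro card_subset_eq) auto
        then show False using "is" d by (auto simp: permutations_of_set_def)
      qed
      then show "vol is * vol is = 0" using kform_eq_0_not_distinct[OF vol] by simp
    qed
  qed
  also have "\<dots> = (\<Sum>is\<in>permutations_of_set (set bs). vol bs * vol bs)"
    using frame_distinct[OF bs]
    by (intro sum.cong refl kform_mult_permuted[OF vol vol])
      (auto simp: permutations_of_set_def set_eq_iff_mset_eq_distinct[symmetric])
  also have "\<dots> = fact ?N * (vol bs * vol bs)"
    by (simp add: card)
  finally show ?thesis .
qed

lemma hodge_frame:
  assumes bs: "orthonormal_frame g bs" and vol: "kform (dim (UNIV :: 'n set)) vol" and \<beta>: "kform p \<beta>"
  shows "hodge g vol \<beta> ws = (if length ws + p = dim (UNIV :: 'n set)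
    then (1 / fact p) * (\<Sum>is | set is \<subseteq> set bs \<and> length is = p. \<beta> is * vol (is @ ws)) else 0)"
proof -
  define cs where "cs = (SOME bs. orthonormal_frame g bs)"
  have cs: "orthonormal_frame g cs"
    unfolding cs_def by (rule someI[where P = "orthonormal_frame g", OF bs])
  define k where "k = dim (UNIV :: 'n set) - length ws"
  have hodge: "hodge g vol \<beta> ws
      = (1 / fact k) * (\<Sum>is | set is \<subseteq> set cs \<and> length is = k. \<beta> is * vol (is @ ws))"
    by (simp add: hodge_def cs_def k_def Let_def)
  show ?thesis
  proof (cases "length ws + p = dim (UNIV :: 'n set)")
    case True
    then have "k = p" by (simp add: k_def)
    moreover have "kform p (\<lambda>is. vol (is @ ws))"
      using vol True by (intro kform_append) (simp add: add.commute)
    ultimately show ?thesis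
      unfolding hodge using sum_lists_frame_independent[OF cs bs \<beta>] True by simp
  next
    case False
    \<comment> \<open>Truncated subtraction still allows k = p here, namely when ws is longer than
      the dimension and p = 0; then it is vol that vanishes.\<close>
    have "\<beta> is * vol (is @ ws) = 0" if "length is = k" for "is"
      using False that kform_eq_0_length[OF \<beta>, of "is"] kform_eq_0_length[OF vol, of "is @ ws"]
      by (cases "k = p") (auto simp: k_def)
    then have "(\<Sum>is | set is \<subseteq> set cs \<and> length is = k. \<beta> is * vol (is @ ws)) = 0"
      by (intro sum.neutral) blast
    then show ?thesis
      unfolding hodge using False by simp
  qed
qed

end

text \<open>\<open>fold\<close> contracts with the head of J first, in accordance with
  (\<star>e^J)(w) = vol(b_J, w).\<close>

definition star_terms :: "(real \<times> nat list) list \<Rightarrow> (real \<times> nat list) list \<Rightarrow> (real \<times> nat list) list" where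
  "star_terms vt cs = concat (map (\<lambda>(c, J). scale_terms c (fold interior_terms J vt)) cs)"

lemma hodge_add: "hodge g vol (\<alpha> + \<beta>) = hodge g vol \<alpha> + hodge g vol \<beta>"
  by (simp add: fun_eq_iff form_apply hodge_def Let_def sum.distrib algebra_simps add_divide_distrib)

lemma hodge_scaleR: "hodge g vol (c *\<^sub>R \<alpha>) = c *\<^sub>R hodge g vol \<alpha>"
  by (simp add: fun_eq_iff form_apply hodge_def Let_def sum_distrib_left mult.assoc)

lemma hodge_zero: "hodge g vol 0 = 0"
  by (simp add: fun_eq_iff form_apply hodge_def Let_def)

section \<open>The metric of a coframe, its Hodge star and its volume form\<close>

context coframe
begin

definition metric :: "'n \<Rightarrow> 'n \<Rightarrow> real" where
  "metric x y = (\<Sum>i\<in>{1..n}. e i [x] * e i [y])"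

lemma linear_e: "i \<in> {1..n} \<Longrightarrow> linear (\<lambda>x. e i [x])"
  using kform_Suc_linear[of 0 "e i" "[]"] kform_e by simp

lemma inj_on_b: "inj_on b {1..n}"
proof (rule inj_onI)
  fix i j assume ij: "i \<in> {1..n}" "j \<in> {1..n}" "b i = b j"
  then show "i = j" using dual[of i i] dual[of i j] by (auto split: if_splits)
qed

lemma metric_b: "i \<in> {1..n} \<Longrightarrow> j \<in> {1..n} \<Longrightarrow> metric (b i) (b j) = (if i = j then 1 else 0)"
proof -
  assume ij: "i \<in> {1..n}" "j \<in> {1..n}"
  then have "metric (b i) (b j) = (\<Sum>k\<in>{1..n}. if k = i then (if i = j then 1 else 0) else 0)"
    unfolding metric_def by (intro sum.cong refl) (auto simp: dual simp del: One_nat_def)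
  then show ?thesis using ij by simp
qed

lemma bilinear_metric: "bilinear metric"
  unfolding bilinear_def metric_def
  by (auto intro!: linearI simp: linear_add[OF linear_e] linear_scale[OF linear_e] sum.distrib
      sum_distrib_left algebra_simps simp del: One_nat_def)

lemma inner_product_metric: "inner_product metric"
  unfolding inner_product_def
proof (intro conjI allI impI bilinear_metric)
  show "metric x y = metric y x" for x y
    by (simp add: metric_def mult.commute)
  fix x :: 'n assume "x \<noteq> 0"
  then obtain i where i: "i \<in> {1..n}" "e i [x] \<noteq> 0"
    using expand[of x] by (metis (no_types, lifting) scaleR_eq_0_iff sum.neutral)
  have "0 < e i [x] * e i [x]"
    using i(2) by (metis not_square_less_zero linorder_neqE_linordered_idom mult_eq_0_iff)
  then show "0 < metric x x"
    unfolding metric_def using i(1) by (intro sum_pos2[of _ i]) auto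
qed

lemma orthonormal_frame_b:
  assumes "dim (UNIV :: 'n set) = n"
  shows "orthonormal_frame metric (map b [1..<Suc n])"
  unfolding orthonormal_frame_def using assms by (auto simp: metric_b simp del: upt_Suc)

lemma monomial_eq_0:
  assumes "set J \<subseteq> {1..n}" "j \<in> set J" "\<And>w. w \<in> set ws \<Longrightarrow> e j [w] = 0"
  shows "monomial e J ws = 0"
  using assms
proof (induction J arbitrary: ws)
  case (Cons i J)
  have "(e i \<and>\<^sub>f monomial e J) ws
      = (\<Sum>m<length ws. (-1) ^ m * (e i [ws ! m] * monomial e J (nths ws (- {m}))))"
    using Cons.prems(1) by (intro wedge_1form[OF kform_e[unfolded One_nat_def] kform_monomial]) auto
  also have "\<dots> = 0"
  proof (intro sum.neutral ballI)
    fix m assume "m \<in> {..<length ws}"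
    then have "e i [ws ! m] = 0 \<or> monomial e J (nths ws (- {m})) = 0"
      using Cons.IH[of "nths ws (- {m})"] Cons.prems notin_set_nthsI by (cases "i = j") fastforce+
    then show "(-1) ^ m * (e i [ws ! m] * monomial e J (nths ws (- {m}))) = 0" by auto
  qed
  finally show ?case by (simp add: monomial_def)
qed simp

lemma monomial_dual:
  assumes "set J \<subseteq> {1..n}" "distinct J"
  shows "monomial e J (map b J) = 1"
  using assms
proof (induction J)
  case Nil
  then show ?case by (simp add: monomial_def unit_form_def)
next
  case (Cons j J)
  have j: "j \<in> {1..n}" and J: "set J \<subseteq> {1..n}" "distinct J" "j \<notin> set J" using Cons.prems by auto
  \<comment> \<open>Every vector still to be inserted is some b_m with m different from j and is
    killed by e_j, so only the term contracting e_j itself survives.\<close>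
  have "(e j \<and>\<^sub>f interior (b j) (monomial e J)) (map b J) = (\<Sum>m<length (map b J). (-1) ^ m
      * (e j [map b J ! m] * interior (b j) (monomial e J) (nths (map b J) (- {m}))))"
    by (rule wedge_1form[OF kform_e[OF j, unfolded One_nat_def] kform_interior_diff[OF kform_monomial[OF J(1)]]])
  also have "\<dots> = 0"
  proof (intro sum.neutral ballI)
    fix m assume "m \<in> {..<length (map b J)}"
    then have "J ! m \<in> set J" by simp
    then have "J ! m \<in> {1..n}" "J ! m \<noteq> j" using J by auto
    then show "(-1) ^ m * (e j [map b J ! m] * interior (b j) (monomial e J) (nths (map b J) (- {m}))) = 0"
      using \<open>m \<in> {..<length (map b J)}\<close> dual[OF j, of "J ! m"] by simp
  qed
  finally have "(e j \<and>\<^sub>f interior (b j) (monomial e J)) (map b J) = 0" .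
  moreover have "(interior (b j) (e j) \<and>\<^sub>f monomial e J) (map b J) = interior (b j) (e j) [] * monomial e J (map b J)"
    using kform_interior[OF kform_e[OF j, unfolded One_nat_def]]
    by (intro wedge_0form[OF _ kform_monomial[OF J(1)]]) simp
  moreover have "interior (b j) (e j) [] = 1"
    using dual[OF j j] by (simp add: interior_apply)
  ultimately show ?case
    using Cons.IH[OF J(1,2)] wedge_Cons[OF kform_e[OF j] kform_monomial[OF J(1)], of "b j" "map b J"]
    by (simp add: monomial_def)
qed

text \<open>If b_j were missing for some j in J, the factor e_j would kill every argument. Since J
  has no repetition, counting leaves exactly the rearrangements of b_J.\<close>

lemma monomial_frame_list:
  assumes J: "set J \<subseteq> {1..n}" "distinct J"
    and "is": "set is \<subseteq> b ` {1..n}" "length is = length J" "monomial e J is \<noteq> 0"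
  shows "is \<in> map b ` permutations_of_set (set J)"
proof -
  have d: "distinct is"
    using "is"(3) kform_eq_0_not_distinct[OF kform_monomial[OF J(1)]] by blast
  have "b j \<in> set is" if "j \<in> set J" for j
  proof (rule ccontr)
    assume nin: "b j \<notin> set is"
    have "e j [w] = 0" if w: "w \<in> set is" for w
    proof -
      obtain i where "i \<in> {1..n}" "w = b i" using "is"(1) w by blast
      with nin w dual[of j i] \<open>j \<in> set J\<close> J(1) show ?thesis by auto
    qed
    then show False using monomial_eq_0[OF J(1) that] "is"(3) by blast
  qed
  moreover have "card (b ` set J) = card (set is)"
    using card_image[OF inj_on_subset[OF inj_on_b J(1)]] distinct_card[OF J(2)] distinct_card[OF d] "is"(2)
    by simp
  ultimately have set_is: "set is = b ` set J"
    by (intro card_subset_eq[symmetric]) auto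
  let ?K = "map (inv_into {1..n} b) is"
  have "map b ?K = is"
    using "is"(1) by (auto simp: map_idI f_inv_into_f subset_iff)
  moreover have "set ?K = set J"
    unfolding set_map set_is by (rule inv_into_image_cancel[OF inj_on_b J(1)])
  moreover have "distinct ?K"
    using \<open>map b ?K = is\<close> d distinct_map by metis
  ultimately show ?thesis
    by (metis image_eqI permutations_of_setI)
qed

lemma form_of_append_arg:
  assumes "set J \<subseteq> {1..n}" "homogeneous n k vt"
  shows "form_of e vt (map b J @ ws) = form_of e (fold interior_terms J vt) ws"
  using assms
proof (induction J arbitrary: k vt)
  case (Cons j J)
  have "form_of e vt (map b (j # J) @ ws) = interior (b j) (form_of e vt) (map b J @ ws)"
    by (simp add: interior_apply)
  also have "\<dots> = form_of e (interior_terms j vt) (map b J @ ws)"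
    using Cons.prems interior_form_of[OF _ Cons.prems(2), of j] by simp
  also have "\<dots> = form_of e (fold interior_terms (j # J) vt) ws"
    using Cons.IH[OF _ homogeneous_interior_terms[OF Cons.prems(2)]] Cons.prems(1) by simp
  finally show ?case .
qed simp

text \<open>Only the \<open>k!\<close> rearrangements of \<open>b\<^sub>J\<close> contribute to \<open>\<star>e\<^sup>J\<close>, all equally, which leaves
  the contraction of the volume form by \<open>b\<^sub>J\<close>.\<close>

lemma hodge_monomial:
  assumes dim: "dim (UNIV :: 'n set) = n" "n \<noteq> 0" and J: "set J \<subseteq> {1..n}" "distinct J"
    and vt: "homogeneous n n vt"
  shows "hodge metric (form_of e vt) (monomial e J) = form_of e (fold interior_terms J vt)"
proof
  fix ws
  interpret inner_product_frame metric
    by unfold_locales (use inner_product_metric dim in auto)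
  let ?vol = "form_of e vt" and ?p = "length J"
  let ?L = "{is. set is \<subseteq> set (map b [1..<Suc n]) \<and> length is = ?p}"
  have vol: "kform (dim (UNIV :: 'n set)) ?vol"
    using kform_form_of[OF vt] dim by simp
  have mono: "kform ?p (monomial e J)"
    by (rule kform_monomial[OF J(1)])
  have set_b: "set (map b [1..<Suc n]) = b ` {1..n}"
    by (simp add: atLeastLessThanSuc_atLeastAtMost del: upt_Suc)
  have hodge: "hodge metric ?vol (monomial e J) ws = (if length ws + ?p = n
      then (1 / fact ?p) * (\<Sum>is\<in>?L. monomial e J is * ?vol (is @ ws)) else 0)"
    using hodge_frame[OF orthonormal_frame_b[OF dim(1)] vol mono] dim(1) by simp
  show "hodge metric ?vol (monomial e J) ws = form_of e (fold interior_terms J vt) ws"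
  proof (cases "length ws + ?p = n")
    case False
    then have "?vol (map b J @ ws) = 0"
      using kform_eq_0_length[OF vol, of "map b J @ ws"] dim(1) by simp
    then show ?thesis
      using form_of_append_arg[OF J(1) vt, of ws] hodge False by simp
  next
    case True
    have vol_ws: "kform ?p (\<lambda>is. ?vol (is @ ws))"
      using vol True dim(1) by (intro kform_append) (simp add: add.commute)
    have "(\<Sum>is\<in>?L. monomial e J is * ?vol (is @ ws))
        = (\<Sum>is\<in>map b ` permutations_of_set (set J). monomial e J is * ?vol (is @ ws))"
    proof (rule sum.mono_neutral_right)
      show "finite ?L"
        by (rule finite_lists_length_eq) simp
      show "map b ` permutations_of_set (set J) \<subseteq> ?L"
        unfolding set_b using J
        by (auto simp: permutations_of_set_def distinct_card[symmetric] subset_iff)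
      show "\<forall>is\<in>?L - map b ` permutations_of_set (set J). monomial e J is * ?vol (is @ ws) = 0"
        unfolding set_b using monomial_frame_list[OF J] by fastforce
    qed
    also have "\<dots> = (\<Sum>K\<in>permutations_of_set (set J). monomial e J (map b K) * ?vol (map b K @ ws))"
    proof (subst sum.reindex)
      show "inj_on (map b) (permutations_of_set (set J))"
        using J(1) by (auto simp: permutations_of_set_def
            intro!: inj_onI map_inj_on[OF _ inj_on_subset[OF inj_on_b]])
    qed simp
    also have "\<dots> = (\<Sum>K\<in>permutations_of_set (set J). monomial e J (map b J) * ?vol (map b J @ ws))"
    proof (rule sum.cong[OF refl])
      fix K assume "K \<in> permutations_of_set (set J)"
      then have "mset K = mset J"
        using J(2) by (auto simp: permutations_of_set_def set_eq_iff_mset_eq_distinct)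
      then have "mset (map b K) = mset (map b J)" by simp
      then show "monomial e J (map b K) * ?vol (map b K @ ws) = monomial e J (map b J) * ?vol (map b J @ ws)"
        by (rule kform_mult_permuted[OF mono vol_ws])
    qed
    also have "\<dots> = fact ?p * ?vol (map b J @ ws)"
      by (simp add: monomial_dual[OF J] distinct_card[OF J(2)])
    finally show ?thesis
      using form_of_append_arg[OF J(1) vt, of ws] hodge True by simp
  qed
qed

lemma hodge_form_of:
  assumes dim: "dim (UNIV :: 'n set) = n" "n \<noteq> 0" and vt: "homogeneous n n vt"
    and "homogeneous n k cs" "\<forall>(c, J)\<in>set cs. distinct J"
  shows "hodge metric (form_of e vt) (form_of e cs) = form_of e (star_terms vt cs)"
  using assms(4,5)
proof (induction cs)
  case Nil
  show ?case by (simp only: form_of_Nil hodge_zero star_terms_def list.map concat.simps)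
next
  case (Cons a cs)
  obtain c J where a: "a = (c, J)" by fastforce
  then have J: "set J \<subseteq> {1..n}" "distinct J" using Cons.prems by auto
  show ?case
    using Cons hodge_monomial[OF dim J vt]
    by (simp add: a hodge_add hodge_scaleR star_terms_def)
qed

lemma volume_form_metric:
  assumes dim: "dim (UNIV :: 'n set) = n" "n \<noteq> 0"
  shows "volume_form metric (form_of e [(1, [1..<Suc n])])"
proof -
  interpret inner_product_frame metric
    by unfold_locales (use inner_product_metric dim in auto)
  let ?vol = "form_of e [(1, [1..<Suc n])]"
  have "kform n ?vol"
    by (rule kform_form_of) (auto simp del: upt_Suc)
  then have vol: "kform (dim (UNIV :: 'n set)) ?vol" using dim by simp
  note b = orthonormal_frame_b[OF dim(1)]
  have "?vol (map b [1..<Suc n]) = 1"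
    using monomial_dual[of "[1..<Suc n]"] by (simp add: form_apply atLeastLessThanSuc_atLeastAtMost del: upt_Suc)
  then have "\<bar>?vol bs\<bar> = 1" if "orthonormal_frame metric bs" for bs
    using sum_lists_frame_independent[OF that b vol vol] sum_lists_frame_top_degree[OF that vol]
      sum_lists_frame_top_degree[OF b vol] by (simp add: abs_square_eq_1[symmetric] power2_eq_square)
  then show ?thesis
    using vol by (simp add: volume_form_def)
qed

end

section \<open>The \<open>G\<^sub>2\<close>-structure\<close>

lemma multi_indices_3: "filter (\<lambda>J. length J = 3) (subseqs [1..<Suc 7]) =
   [[1,2,3], [1,2,4], [1,2,5], [1,2,6], [1,2,7], [1,3,4], [1,3,5], [1,3,6], [1,3,7], [1,4,5],
    [1,4,6], [1,4,7], [1,5,6], [1,5,7], [1,6,7], [2,3,4], [2,3,5], [2,3,6], [2,3,7], [2,4,5],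
    [2,4,6], [2,4,7], [2,5,6], [2,5,7], [2,6,7], [3,4,5], [3,4,6], [3,4,7], [3,5,6], [3,5,7],
    [3,6,7], [4,5,6], [4,5,7], [4,6,7], [5,6,7]]"
  by code_simp

lemma multi_indices_4: "filter (\<lambda>J. length J = 4) (subseqs [1..<Suc 7]) =
   [[1,2,3,4], [1,2,3,5], [1,2,3,6], [1,2,3,7], [1,2,4,5], [1,2,4,6], [1,2,4,7], [1,2,5,6],
    [1,2,5,7], [1,2,6,7], [1,3,4,5], [1,3,4,6], [1,3,4,7], [1,3,5,6], [1,3,5,7], [1,3,6,7],
    [1,4,5,6], [1,4,5,7], [1,4,6,7], [1,5,6,7], [2,3,4,5], [2,3,4,6], [2,3,4,7], [2,3,5,6],
    [2,3,5,7], [2,3,6,7], [2,4,5,6], [2,4,5,7], [2,4,6,7], [2,5,6,7], [3,4,5,6], [3,4,5,7],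
    [3,4,6,7], [3,5,6,7], [4,5,6,7]]"
  by code_simp

lemma multi_indices_5: "filter (\<lambda>J. length J = 5) (subseqs [1..<Suc 7]) =
   [[1,2,3,4,5], [1,2,3,4,6], [1,2,3,4,7], [1,2,3,5,6], [1,2,3,5,7], [1,2,3,6,7], [1,2,4,5,6],
    [1,2,4,5,7], [1,2,4,6,7], [1,2,5,6,7], [1,3,4,5,6], [1,3,4,5,7], [1,3,4,6,7], [1,3,5,6,7],
    [1,4,5,6,7], [2,3,4,5,6], [2,3,4,5,7], [2,3,4,6,7], [2,3,5,6,7], [2,4,5,6,7], [3,4,5,6,7]]"
  by code_simp

lemma multi_indices_6: "filter (\<lambda>J. length J = 6) (subseqs [1..<Suc 7]) =
   [[1,2,3,4,5,6], [1,2,3,4,5,7], [1,2,3,4,6,7], [1,2,3,5,6,7], [1,2,4,5,6,7], [1,3,4,5,6,7],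
    [2,3,4,5,6,7]]"
  by code_simp

lemma multi_indices_7: "filter (\<lambda>J. length J = 7) (subseqs [1..<Suc 7]) =
   [[1,2,3,4,5,6,7]]"
  by code_simp

definition phi_terms :: "(real \<times> nat list) list" where
  "phi_terms = [(1, [1,3,5]), (-1, [2,4,5]), (-1, [1,4,6]), (-1, [2,3,6]), (1, [1,2,7]),
     (1, [3,4,7]), (1, [5,6,7])]"

text \<open>This is e^{1234} + \<sigma>_1^+ \<and> e^{67} + \<sigma>_2^+ \<and> e^{75} +
  \<sigma>_3^+ \<and> e^{56}, listed in the order in which \<open>star_terms\<close> produces it
  from \<open>phi_terms\<close>, so that \<open>star_phi_terms\<close> is a literal equality of
  lists.\<close>

definition psi_terms :: "(real \<times> nat list) list" where
  "psi_terms = [(-1, [2,4,6,7]), (1, [1,3,6,7]), (1, [2,3,5,7]), (1, [1,4,5,7]), (1, [3,4,5,6]),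
     (1, [1,2,5,6]), (1, [1,2,3,4])]"

definition vol_terms :: "(real \<times> nat list) list" where
  "vol_terms = [(1, [1,2,3,4,5,6,7])]"

definition de_terms :: "real \<Rightarrow> real \<Rightarrow> real \<Rightarrow> real \<Rightarrow> nat \<Rightarrow> (real \<times> nat list) list" where
  "de_terms \<delta> \<epsilon>1 \<epsilon>2 \<epsilon>3 i =
     (if i = 5 then [(\<delta> + \<epsilon>1, [1,3]), (\<epsilon>1 - \<delta>, [2,4])]
      else if i = 6 then [(\<epsilon>2 - \<delta>, [1,4]), (- \<delta> - \<epsilon>2, [2,3])]
      else if i = 7 then [(\<delta> + \<epsilon>3, [1,2]), (\<delta> - \<epsilon>3, [3,4])]
      else [])"

text \<open>The coefficient 6 \<delta> collects \<delta> \<sigma>_i^+ \<and> \<sigma>_i^+ = 2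
  \<delta> e^{1234} for i = 1, 2, 3; the other six terms are the differential of e^{567}.\<close>

definition dphi_terms :: "real \<Rightarrow> real \<Rightarrow> real \<Rightarrow> real \<Rightarrow> (real \<times> nat list) list" where
  "dphi_terms \<delta> \<epsilon>1 \<epsilon>2 \<epsilon>3 =
     [(6 * \<delta>, [1,2,3,4]), (\<delta> + \<epsilon>1, [1,3,6,7]), (\<epsilon>1 - \<delta>, [2,4,6,7]), (\<delta> - \<epsilon>2, [1,4,5,7]),
      (\<delta> + \<epsilon>2, [2,3,5,7]), (\<delta> + \<epsilon>3, [1,2,5,6]), (\<delta> - \<epsilon>3, [3,4,5,6])]"

definition torsion_terms :: "real \<Rightarrow> real \<Rightarrow> real \<Rightarrow> real \<Rightarrow> (real \<times> nat list) list" where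
  "torsion_terms \<delta> \<epsilon>1 \<epsilon>2 \<epsilon>3 =
     [(\<delta> + \<epsilon>1, [1,3,5]), (\<epsilon>1 - \<delta>, [2,4,5]), (\<epsilon>2 - \<delta>, [1,4,6]), (- \<delta> - \<epsilon>2, [2,3,6]),
      (\<delta> + \<epsilon>3, [1,2,7]), (\<delta> - \<epsilon>3, [3,4,7]), (- 4 * \<delta>, [5,6,7])]"

text \<open>For \<open>i = 5, 6, 7\<close> the components of \<open>F\<^sub>A\<close> along \<open>Y\<^sub>i\<close>; other values of \<open>i\<close> are junk.\<close>

definition curvature_terms :: "real \<Rightarrow> real \<Rightarrow> real \<Rightarrow> real \<Rightarrow> nat \<Rightarrow> (real \<times> nat list) list" where
  "curvature_terms \<delta> \<epsilon>1 \<epsilon>2 \<epsilon>3 i = de_terms \<delta> \<epsilon>1 \<epsilon>2 \<epsilon>3 i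
     @ [(- 2 * \<delta>, if i = 5 then [6,7] else if i = 6 then [7,5] else [5,6])]"

lemmas term_eval = wedge_terms_def interior_terms_def scale_terms_def star_terms_def

lemma upt_7: "[1..<Suc 7] = [1,2,3,4,5,6,7]"
  by code_simp

lemma ext_d_terms_7:
  "ext_d_terms 7 de cs = concat (map (\<lambda>i. wedge_terms (de i) (interior_terms i cs)) [1,2,3,4,5,6,7])"
  unfolding ext_d_terms_def upt_7 ..

lemma homogeneous_terms:
  "homogeneous 7 3 phi_terms" "homogeneous 7 4 psi_terms" "homogeneous 7 7 vol_terms"
  "homogeneous 7 2 (de_terms \<delta> \<epsilon>1 \<epsilon>2 \<epsilon>3 i)" "homogeneous 7 4 (dphi_terms \<delta> \<epsilon>1 \<epsilon>2 \<epsilon>3)"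
  "homogeneous 7 3 (torsion_terms \<delta> \<epsilon>1 \<epsilon>2 \<epsilon>3)" "homogeneous 7 2 (curvature_terms \<delta> \<epsilon>1 \<epsilon>2 \<epsilon>3 i)"
  by (simp_all add: phi_terms_def psi_terms_def vol_terms_def de_terms_def dphi_terms_def
      torsion_terms_def curvature_terms_def)

lemma contraction_coefficients:
  "\<forall>i\<in>set [1,2,3,4,5,6,7]. \<forall>j\<in>set [1,2,3,4,5,6,7]. coefficient (wedge_terms (wedge_terms (interior_terms i phi_terms)
     (interior_terms j phi_terms)) phi_terms) [1,2,3,4,5,6,7] = (if i = j then 6 else 0)"
  by code_simp

lemma star_phi_terms: "star_terms vol_terms phi_terms = psi_terms"
  by code_simp

lemma wedge_minus_left: "(- \<alpha>) \<and>\<^sub>f \<beta> = - (\<alpha> \<and>\<^sub>f \<beta>)"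
  using wedge_scaleR_left[of "-1" \<alpha> \<beta>] by simp

lemma wedge_diff_left: "(\<alpha> - \<beta>) \<and>\<^sub>f \<gamma> = \<alpha> \<and>\<^sub>f \<gamma> - \<beta> \<and>\<^sub>f \<gamma>"
  using wedge_add_left[of \<alpha> "- \<beta>" \<gamma>] by (simp add: wedge_minus_left)

lemma kform_scale_args:
  "kform k \<alpha> \<Longrightarrow> \<alpha> (map (\<lambda>v. c *\<^sub>R v) vs) = c ^ length vs *\<^sub>R \<alpha> vs"
proof (induction vs arbitrary: k \<alpha>)
  case (Cons v vs)
  show ?case
  proof (cases k)
    case 0
    then show ?thesis using kform_eq_0_length[OF Cons.prems] by simp
  next
    case (Suc k')
    have "\<alpha> (map (\<lambda>v. c *\<^sub>R v) (v # vs)) = c *\<^sub>R interior v \<alpha> (map (\<lambda>v. c *\<^sub>R v) vs)"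
      using linear_scale[OF kform_Suc_linear, of k' \<alpha>] Cons.prems Suc by (simp add: interior_apply)
    also have "interior v \<alpha> (map (\<lambda>v. c *\<^sub>R v) vs) = c ^ length vs *\<^sub>R interior v \<alpha> vs"
      by (rule Cons.IH[OF kform_interior_diff[OF Cons.prems]])
    finally show ?thesis by (simp add: interior_apply)
  qed
qed simp

section \<open>The form \<phi> with its metric, volume form and star\<close>

locale coframe7 = coframe 7 e b for e :: "nat \<Rightarrow> 'n::real_vector list \<Rightarrow> real" and b +
  assumes dim_7: "dim (UNIV :: 'n set) = 7"
begin

abbreviation "phi \<equiv> form_of e phi_terms"
abbreviation "vol7 \<equiv> form_of e vol_terms"

lemma e_wedge_monomial: "e i \<and>\<^sub>f monomial e J = monomial e (i # J)"
  by (simp add: monomial_def)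

lemma e_wedge_e: "j \<in> {1..7} \<Longrightarrow> e i \<and>\<^sub>f e j = monomial e [i, j]"
  using e_eq_monomial[of j] e_wedge_monomial[of i "[j]"] by simp

lemma monomial_wedge_e: "set I \<subseteq> {1..7} \<Longrightarrow> j \<in> {1..7} \<Longrightarrow> monomial e I \<and>\<^sub>f e j = monomial e (I @ [j])"
  using e_eq_monomial[of j] monomial_wedge_monomial[of I "[j]"] by simp

lemma phi_eq:
  "sigma_plus e 1 \<and>\<^sub>f e 5 + sigma_plus e 2 \<and>\<^sub>f e 6 + sigma_plus e 3 \<and>\<^sub>f e 7 + e 5 \<and>\<^sub>f e 6 \<and>\<^sub>f e 7 = phi"
  by (simp add: sigma_plus_def wedge_diff_left wedge_minus_left wedge_add_left e_wedge_e
      e_wedge_monomial monomial_wedge_e phi_terms_def)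

lemma de_eq:
  "\<delta> *\<^sub>R sigma_plus e 1 + \<epsilon>1 *\<^sub>R sigma_minus e 1 = form_of e (de_terms \<delta> \<epsilon>1 \<epsilon>2 \<epsilon>3 5)"
  "\<delta> *\<^sub>R sigma_plus e 2 + \<epsilon>2 *\<^sub>R sigma_minus e 2 = form_of e (de_terms \<delta> \<epsilon>1 \<epsilon>2 \<epsilon>3 6)"
  "\<delta> *\<^sub>R sigma_plus e 3 + \<epsilon>3 *\<^sub>R sigma_minus e 3 = form_of e (de_terms \<delta> \<epsilon>1 \<epsilon>2 \<epsilon>3 7)"
  by (simp_all add: sigma_plus_def sigma_minus_def e_wedge_e de_terms_def algebra_simps)

lemma g2_structure_phi:
  assumes "dual_basis e 7"
  shows "g2_structure phi"
proof -
  \<comment> \<open>The new coframe is f = (e^7, e^1, ..., e^6): in the model the first covector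
    multiplies f^{23} + f^{45} + f^{67}, and here e^7 multiplies \<sigma>_3^+ + e^{56} = e^{12} +
    e^{34} + e^{56}.\<close>
  let ?p = "\<lambda>i::nat. if i = 1 then 7 else i - 1"
  let ?f = "\<lambda>i. e (?p i)"
  have img: "?p ` {1..7} = {1..7}"
    by code_simp
  have inj: "inj_on ?p {1..7}"
    by (auto simp: inj_on_def split: if_splits)
  have "inj_on (e \<circ> ?p) {1..7}"
    using assms by (intro comp_inj_on[OF inj]) (simp only: img dual_basis_def)
  then have "inj_on ?f {1..7}" by (simp only: comp_def)
  moreover have "?f ` {1..7} = e ` {1..7}"
    using img by (metis image_image)
  ultimately have "dual_basis ?f 7"
    using assms by (simp add: dual_basis_def)
  moreover have "phi = form_of e [(1, [7,1,2]), (1, [7,3,4]), (1, [7,5,6]), (1, [1,3,5]), (-1, [1,4,6]),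
      (-1, [2,3,6]), (-1, [2,4,5])]"
    by (rule form_of_eqI[where k = 3]) (simp_all only: multi_indices_3, simp_all add: phi_terms_def term_eval)
  then have "phi = ?f 1 \<and>\<^sub>f ?f 2 \<and>\<^sub>f ?f 3 + ?f 1 \<and>\<^sub>f ?f 4 \<and>\<^sub>f ?f 5 + ?f 1 \<and>\<^sub>f ?f 6 \<and>\<^sub>f ?f 7 + ?f 2 \<and>\<^sub>f ?f 4 \<and>\<^sub>f ?f 6
         - ?f 2 \<and>\<^sub>f ?f 5 \<and>\<^sub>f ?f 7 - ?f 3 \<and>\<^sub>f ?f 4 \<and>\<^sub>f ?f 7 - ?f 3 \<and>\<^sub>f ?f 5 \<and>\<^sub>f ?f 6"
    by (simp add: e_wedge_e e_wedge_monomial)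
  ultimately show ?thesis
    unfolding g2_structure_def by blast
qed

lemma top_form:
  assumes "homogeneous 7 7 cs"
  shows "form_of e cs = coefficient cs [1,2,3,4,5,6,7] *\<^sub>R vol7"
proof -
  have "form_of e cs = form_of e (scale_terms (coefficient cs [1,2,3,4,5,6,7]) vol_terms)"
  proof (rule form_of_eqI[OF assms])
    show "\<forall>is\<in>set (filter (\<lambda>J. length J = 7) (subseqs [1..<Suc 7])). coefficient cs is
        = coefficient (scale_terms (coefficient cs [1,2,3,4,5,6,7]) vol_terms) is"
      unfolding multi_indices_7
      by (simp add: vol_terms_def term_eval del: coefficient.simps)
         (simp add: term_eval)
  qed (simp add: homogeneous_terms)
  then show ?thesis by simp
qed

lemma contraction_b:
  assumes "i \<in> {1..7}" "j \<in> {1..7}"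
  shows "(interior (b i) phi \<and>\<^sub>f interior (b j) phi) \<and>\<^sub>f phi = (if i = j then 6 else 0) *\<^sub>R vol7"
proof -
  note h = homogeneous_terms(1)
  note hi = homogeneous_interior_terms[OF h]
  have "(interior (b i) phi \<and>\<^sub>f interior (b j) phi) \<and>\<^sub>f phi
      = form_of e (wedge_terms (wedge_terms (interior_terms i phi_terms) (interior_terms j phi_terms)) phi_terms)"
    using interior_form_of[OF _ h] assms form_of_wedge_form_of[OF hi hi]
      form_of_wedge_form_of[OF homogeneous_wedge_terms[OF hi hi] h] by simp
  also have "\<dots> = (if i = j then 6 else 0) *\<^sub>R vol7"
  proof -
    let ?cs = "wedge_terms (wedge_terms (interior_terms i phi_terms) (interior_terms j phi_terms)) phi_terms"
    have "i \<in> set [1,2,3,4,5,6,7]" "j \<in> set [1,2,3,4,5,6,7]"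
      using assms unfolding upt_7[symmetric] by (simp_all del: upt_Suc)
    then have "coefficient ?cs [1,2,3,4,5,6,7] = (if i = j then 6 else 0)"
      using contraction_coefficients by blast
    moreover have "homogeneous 7 7 ?cs"
      using homogeneous_wedge_terms[OF homogeneous_wedge_terms[OF hi hi] h] by simp
    ultimately show ?thesis
      by (simp only: top_form)
  qed
  finally show ?thesis .
qed

lemma contraction:
  "(interior X phi \<and>\<^sub>f interior Y phi) \<and>\<^sub>f phi = (6 * metric X Y) *\<^sub>R vol7"
proof -
  have lin: "linear (\<lambda>v. interior v phi)"
    by (rule linear_interior[OF kform_form_of[OF homogeneous_terms(1)]])
  have lin1: "linear (\<lambda>x. (interior x phi \<and>\<^sub>f \<beta>) \<and>\<^sub>f phi)" for \<beta>
    by (rule linearI) (simp_all add: linear_add[OF lin] linear_scale[OF lin] wedge_add_left wedge_scaleR_left)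
  have lin2: "linear (\<lambda>y. (\<alpha> \<and>\<^sub>f interior y phi) \<and>\<^sub>f phi)" for \<alpha>
    by (rule linearI) (simp_all add: linear_add[OF lin] linear_scale[OF lin] wedge_add_left
        wedge_scaleR_left wedge_add_right wedge_scaleR_right)
  have "(interior X phi \<and>\<^sub>f interior Y phi) \<and>\<^sub>f phi
      = (\<Sum>i\<in>{1..7}. e i [X] *\<^sub>R (\<Sum>j\<in>{1..7}. e j [Y] *\<^sub>R ((interior (b i) phi \<and>\<^sub>f interior (b j) phi) \<and>\<^sub>f phi)))"
    by (subst linear_expand[OF lin1], subst linear_expand[OF lin2]) (rule refl)
  also have "\<dots> = (\<Sum>i\<in>{1..7}. (6 * (e i [X] * e i [Y])) *\<^sub>R vol7)"
  proof (rule sum.cong[OF refl])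
    fix i :: nat assume i: "i \<in> {1..7}"
    have "(\<Sum>j\<in>{1..7}. e j [Y] *\<^sub>R ((interior (b i) phi \<and>\<^sub>f interior (b j) phi) \<and>\<^sub>f phi))
        = (\<Sum>j\<in>{1..7}. if j = i then (6 * e i [Y]) *\<^sub>R vol7 else 0)"
      by (rule sum.cong[OF refl]) (use contraction_b[OF i] in auto)
    then show "e i [X] *\<^sub>R (\<Sum>j\<in>{1..7}. e j [Y] *\<^sub>R ((interior (b i) phi \<and>\<^sub>f interior (b j) phi) \<and>\<^sub>f phi))
        = (6 * (e i [X] * e i [Y])) *\<^sub>R vol7"
      using i by (simp add: mult.left_commute)
  qed
  finally show ?thesis
    by (simp add: metric_def scaleR_sum_left sum_distrib_left)
qed

lemma vol_terms_upt: "vol_terms = [(1, [1..<Suc 7])]"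
  unfolding vol_terms_def upt_7 ..

lemma is_g2_metric_vol_phi: "is_g2_metric_vol phi metric vol7"
  unfolding is_g2_metric_vol_def
  using inner_product_metric volume_form_metric dim_7 contraction by (simp add: vol_terms_upt del: upt_Suc)

text \<open>The defining equation determines \<open>(g, vol)\<close> up to \<open>(c g, vol / c)\<close>; in a \<open>g\<close>-orthonormal
  frame the normalisation of \<open>vol\<close> forces \<open>c\<^sup>9 = 1\<close>.\<close>

lemma is_g2_metric_vol_unique:
  assumes "is_g2_metric_vol phi g vol"
  shows "g = metric" "vol = vol7"
proof -
  have g: "inner_product g" and vol: "volume_form g vol"
    and eq: "(6 * g X Y) *\<^sub>R vol = (6 * metric X Y) *\<^sub>R vol7" for X Y
    using assms contraction by (simp_all add: is_g2_metric_vol_def)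
  let ?B = "map b [1..<Suc 7]"
  have "set [1..<Suc 7] \<subseteq> {1..7}" by auto
  from monomial_dual[OF this distinct_upt] have vol7_B: "vol7 ?B = 1"
    by (simp add: vol_terms_upt form_apply del: upt_Suc)
  have eq_b: "g X Y * vol ?B = metric X Y" for X Y
    using fun_cong[OF eq[of X Y], of ?B] vol7_B by (simp add: form_apply del: upt_Suc)
  define v where "v = vol ?B"
  \<comment> \<open>Positivity of both metrics at b_1 fixes the sign of v, which excludes the
    opposite orientation.\<close>
  have "b 1 \<noteq> 0"
    using dual[of 1 1] linear_0[OF linear_e[of 1]] by auto
  then have "g (b 1) (b 1) > 0" using g by (simp add: inner_product_def)
  moreover have "g (b 1) (b 1) * v = 1"
    using eq_b[of "b 1" "b 1"] metric_b[of 1 1] by (simp add: v_def)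
  ultimately have v: "v > 0"
    by (metis zero_less_mult_pos zero_less_one)
  \<comment> \<open>Since g is the coframe metric divided by v, the vectors s b_i with s^2 = v are
    g-orthonormal, and vol takes the value v s^7 = s^9 on them.\<close>
  define s where "s = sqrt v"
  have s: "s > 0" "s * s = v" using v by (simp_all add: s_def)
  have gm: "g X Y = metric X Y / v" for X Y
    using eq_b[of X Y] v by (simp add: v_def field_simps)
  have "vol vs = v * vol7 vs" for vs
    using fun_cong[OF eq[of "b 1" "b 1"], of vs] metric_b[of 1 1] v
    by (simp add: gm form_apply field_simps)
  then have volv: "vol = v *\<^sub>R vol7"
    by (simp add: fun_eq_iff form_apply)
  have "bilinear metric" by (rule bilinear_metric)
  then have "metric (s *\<^sub>R x) (s *\<^sub>R y) = v * metric x y" for x y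
    by (simp add: bilinear_lmul bilinear_rmul s(2)[symmetric])
  then have "orthonormal_frame g (map (\<lambda>v. s *\<^sub>R v) ?B)"
    using orthonormal_frame_b[OF dim_7] v unfolding orthonormal_frame_def by (auto simp: gm simp del: upt_Suc)
  then have "\<bar>vol (map (\<lambda>v. s *\<^sub>R v) ?B)\<bar> = 1"
    using vol unfolding volume_form_def by blast
  then have "v * s ^ 7 = 1"
    using kform_scale_args[OF kform_form_of[OF homogeneous_terms(3)], of s ?B] vol7_B v s
    by (simp add: volv form_apply abs_mult del: upt_Suc)
  then have "s ^ 9 = 1 ^ 9"
    by (simp add: s(2)[symmetric] power_numeral_reduce mult.assoc)
  then have "s = 1"
    using s(1) by (intro power_eq_imp_eq_base[of s 9 1]) auto
  then have "v = 1" using s(2) by simp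
  then show "g = metric" "vol = vol7"
    using gm volv by (auto simp: fun_eq_iff)
qed

lemma g2_metric_vol_phi: "g2_metric_vol phi = (metric, vol7)"
  unfolding g2_metric_vol_def
proof (rule the_equality)
  show "is_g2_metric_vol phi (fst (metric, vol7)) (snd (metric, vol7))"
    using is_g2_metric_vol_phi by simp
  show "gv = (metric, vol7)" if "is_g2_metric_vol phi (fst gv) (snd gv)" for gv
    using is_g2_metric_vol_unique[OF that] by (simp add: prod_eq_iff)
qed

lemma g2_star_form_of:
  assumes "homogeneous 7 k cs" "\<forall>(c, J)\<in>set cs. distinct J"
  shows "g2_star phi (form_of e cs) = form_of e (star_terms vol_terms cs)"
  unfolding g2_star_def g2_metric_vol_phi fst_conv snd_conv
  using assms dim_7 homogeneous_terms(3) by (intro hodge_form_of) auto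

lemma g2_star_zero: "g2_star phi 0 = 0"
  using g2_star_form_of[of 0 "[]"] by (simp add: star_terms_def)

lemma g2_psi_phi: "g2_psi phi = form_of e psi_terms"
proof -
  have "\<forall>(c, J)\<in>set phi_terms. distinct J" by (simp add: phi_terms_def)
  from g2_star_form_of[OF homogeneous_terms(1) this] show ?thesis
    by (simp only: g2_psi_def star_phi_terms)
qed

end

section \<open>Reducing vector-valued wedge products to scalar ones\<close>

lemma sum_sum_list: "(\<Sum>i\<in>I. \<Sum>x\<leftarrow>L. h i x) = (\<Sum>x\<leftarrow>L. \<Sum>i\<in>I. h i x)"
  by (induction L) (simp_all add: sum.distrib)

lemma scaleR_sum_list:
  fixes h :: "'b \<Rightarrow> 'a::real_vector"
  shows "r *\<^sub>R (\<Sum>x\<leftarrow>L. h x) = (\<Sum>x\<leftarrow>L. r *\<^sub>R h x)"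
  by (induction L) (simp_all add: scaleR_add_right)

text \<open>If the values combine into finitely many products of scalar forms with constant vectors,
  the permutation sum distributes over them. It serves the bracket, the multiplication by \<psi> and
  the pairing alike.\<close>

lemma wedge_with_expand:
  assumes "\<And>xs ys. B (\<alpha> xs) (\<beta> ys) = (\<Sum>(\<theta>, \<eta>, c)\<leftarrow>L. (\<theta> xs * \<eta> ys) *\<^sub>R c)"
  shows "wedge_with B \<alpha> \<beta> vs = (\<Sum>(\<theta>, \<eta>, c)\<leftarrow>L. (\<theta> \<and>\<^sub>f \<eta>) vs *\<^sub>R c)"
  unfolding wedge_with_def Let_def assms scaleR_sum_list sum_sum_list
  by (intro arg_cong[of _ _ sum_list] map_cong refl)
    (auto simp: scaleR_sum_left scaleR_sum_right sum_distrib_left)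

section \<open>Co-closedness, torsion and the curvature identities\<close>

context coframe7
begin

lemma ext_d_phi:
  assumes "\<And>i. i \<in> {1..7} \<Longrightarrow> ext_d br (e i) = form_of e (de_terms \<delta> \<epsilon>1 \<epsilon>2 \<epsilon>3 i)"
  shows "ext_d br phi = form_of e (dphi_terms \<delta> \<epsilon>1 \<epsilon>2 \<epsilon>3)"
proof -
  have "ext_d br phi = form_of e (ext_d_terms 7 (de_terms \<delta> \<epsilon>1 \<epsilon>2 \<epsilon>3) phi_terms)"
    by (rule ext_d_form_of[OF homogeneous_terms(1) assms homogeneous_terms(4)])
  also have "\<dots> = form_of e (dphi_terms \<delta> \<epsilon>1 \<epsilon>2 \<epsilon>3)"
  proof (rule form_of_eqI[OF _ homogeneous_terms(5)])
    show "homogeneous 7 4 (ext_d_terms 7 (de_terms \<delta> \<epsilon>1 \<epsilon>2 \<epsilon>3) phi_terms)"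
      by (simp add: ext_d_terms_7 de_terms_def phi_terms_def term_eval)
    show "\<forall>is\<in>set (filter (\<lambda>J. length J = 4) (subseqs [1..<Suc 7])).
      coefficient (ext_d_terms 7 (de_terms \<delta> \<epsilon>1 \<epsilon>2 \<epsilon>3) phi_terms) is = coefficient (dphi_terms \<delta> \<epsilon>1 \<epsilon>2 \<epsilon>3) is"
      unfolding multi_indices_4
      by (simp add: ext_d_terms_7 de_terms_def phi_terms_def dphi_terms_def term_eval)
  qed
  finally show ?thesis .
qed

text \<open>Differentiating \<psi> produces only products of some \<sigma>_i^+ with the differential
  belonging to another index j. They vanish, since \<sigma>_i^+ wedges to 0 with \<sigma>_j^+ for
  different i, j and with every \<sigma>_j^-.\<close>

lemma coclosed_phi:
  assumes "\<And>i. i \<in> {1..7} \<Longrightarrow> ext_d br (e i) = form_of e (de_terms \<delta> \<epsilon>1 \<epsilon>2 \<epsilon>3 i)"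
  shows "coclosed br phi"
proof -
  have "ext_d br (form_of e psi_terms) = form_of e (ext_d_terms 7 (de_terms \<delta> \<epsilon>1 \<epsilon>2 \<epsilon>3) psi_terms)"
    by (rule ext_d_form_of[OF homogeneous_terms(2) assms homogeneous_terms(4)])
  also have "\<dots> = form_of e []"
  proof (rule form_of_eqI)
    show "homogeneous 7 5 (ext_d_terms 7 (de_terms \<delta> \<epsilon>1 \<epsilon>2 \<epsilon>3) psi_terms)"
      by (simp add: ext_d_terms_7 de_terms_def psi_terms_def term_eval)
    show "\<forall>is\<in>set (filter (\<lambda>J. length J = 5) (subseqs [1..<Suc 7])).
      coefficient (ext_d_terms 7 (de_terms \<delta> \<epsilon>1 \<epsilon>2 \<epsilon>3) psi_terms) is = coefficient [] is"
      unfolding multi_indices_5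
      by (simp add: ext_d_terms_7 de_terms_def psi_terms_def term_eval)
  qed simp
  finally show ?thesis by (simp add: coclosed_def g2_psi_phi)
qed

text \<open>One half of 12 \<delta> is 6 \<delta> e^{1234} meeting e^{567}; the other is de^5 \<and>
  e^{67} meeting \<sigma>_1^+ \<and> e^5 in 2 \<delta> times the volume form, together with the two
  cyclic analogues.\<close>

lemma star_top_phi:
  assumes "\<And>i. i \<in> {1..7} \<Longrightarrow> ext_d br (e i) = form_of e (de_terms \<delta> \<epsilon>1 \<epsilon>2 \<epsilon>3 i)"
  shows "g2_star phi (ext_d br phi \<and>\<^sub>f phi) [] = 12 * \<delta>"
proof -
  have d: "ext_d br phi = form_of e (dphi_terms \<delta> \<epsilon>1 \<epsilon>2 \<epsilon>3)"
    by (rule ext_d_phi) (rule assms)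
  let ?cs = "wedge_terms (dphi_terms \<delta> \<epsilon>1 \<epsilon>2 \<epsilon>3) phi_terms"
  have "homogeneous 7 7 ?cs"
    using homogeneous_wedge_terms[OF homogeneous_terms(5,1)] by simp
  moreover have "coefficient ?cs [1,2,3,4,5,6,7] = 12 * \<delta>"
    by (simp add: dphi_terms_def phi_terms_def term_eval)
  ultimately have "form_of e ?cs = form_of e (scale_terms (12 * \<delta>) vol_terms)"
    using top_form by simp
  then have "ext_d br phi \<and>\<^sub>f phi = form_of e [(12 * \<delta>, [1,2,3,4,5,6,7])]"
    unfolding d form_of_wedge_form_of[OF homogeneous_terms(5,1)]
    by (simp add: vol_terms_def scale_terms_def)
  moreover have "g2_star phi (form_of e [(12 * \<delta>, [1,2,3,4,5,6,7])])
      = form_of e (star_terms vol_terms [(12 * \<delta>, [1,2,3,4,5,6,7])])"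
    by (rule g2_star_form_of[of 7]) simp_all
  ultimately show ?thesis
    by (simp add: vol_terms_def term_eval monomial_def form_apply unit_form_def)
qed

text \<open>\<star>d\<phi> is a combination of e^{567} and of the products of \<sigma>_i^+ or
  \<sigma>_i^- with e^{i+4}. In the product with \<phi>, equal i repeat a covector, unequal i give a
  vanishing product of two \<sigma>s, and e^{567} repeats a covector with everything.\<close>

lemma tau1_phi:
  assumes "\<And>i. i \<in> {1..7} \<Longrightarrow> ext_d br (e i) = form_of e (de_terms \<delta> \<epsilon>1 \<epsilon>2 \<epsilon>3 i)"
  shows "tau1 br phi = 0"
proof -
  have d: "ext_d br phi = form_of e (dphi_terms \<delta> \<epsilon>1 \<epsilon>2 \<epsilon>3)"
    by (rule ext_d_phi) (rule assms)
  let ?s = "star_terms vol_terms (dphi_terms \<delta> \<epsilon>1 \<epsilon>2 \<epsilon>3)"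
  have star: "g2_star phi (ext_d br phi) = form_of e ?s"
    unfolding d
    by (rule g2_star_form_of[OF homogeneous_terms(5)]) (simp add: dphi_terms_def)
  have s: "homogeneous 7 3 ?s"
    by (simp add: vol_terms_def dphi_terms_def term_eval)
  have "form_of e (wedge_terms phi_terms ?s) = form_of e []"
  proof (rule form_of_eqI)
    show "homogeneous 7 6 (wedge_terms phi_terms ?s)"
      using homogeneous_wedge_terms[OF homogeneous_terms(1) s] by simp
    show "\<forall>is\<in>set (filter (\<lambda>J. length J = 6) (subseqs [1..<Suc 7])).
      coefficient (wedge_terms phi_terms ?s) is = coefficient [] is"
      unfolding multi_indices_6
      by (simp add: vol_terms_def phi_terms_def dphi_terms_def term_eval)
  qed simp
  then have "phi \<and>\<^sub>f g2_star phi (ext_d br phi) = 0"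
    unfolding star form_of_wedge_form_of[OF homogeneous_terms(1) s] by simp
  then show ?thesis by (simp add: tau1_def g2_star_zero)
qed

text \<open>The star sends \<sigma>_1^+ \<and> e^{67} to \<sigma>_1^+ \<and> e^5 and \<sigma>_1^-
  \<and> e^{67} to - \<sigma>_1^- \<and> e^5. So subtracting \<star>d\<phi> from 2 \<delta> \<phi>
  leaves 2 \<delta> - \<delta> on \<sigma>_1^+ and +\<epsilon>_1 on \<sigma>_1^-, which is de^5
  again, and 2 \<delta> - 6 \<delta> on e^{567}.\<close>

lemma g2_torsion_phi:
  assumes "\<And>i. i \<in> {1..7} \<Longrightarrow> ext_d br (e i) = form_of e (de_terms \<delta> \<epsilon>1 \<epsilon>2 \<epsilon>3 i)"
  shows "g2_torsion br phi = form_of e (torsion_terms \<delta> \<epsilon>1 \<epsilon>2 \<epsilon>3)"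
proof -
  have d: "ext_d br phi = form_of e (dphi_terms \<delta> \<epsilon>1 \<epsilon>2 \<epsilon>3)"
    by (rule ext_d_phi) (rule assms)
  have "g2_star phi (ext_d br phi) = form_of e (star_terms vol_terms (dphi_terms \<delta> \<epsilon>1 \<epsilon>2 \<epsilon>3))"
    unfolding d
    by (rule g2_star_form_of[OF homogeneous_terms(5)]) (simp add: dphi_terms_def)
  moreover have "g2_star phi (ext_d br phi \<and>\<^sub>f phi) [] = 12 * \<delta>"
    by (rule star_top_phi) (rule assms)
  moreover have "tau1 br phi = 0"
    by (rule tau1_phi) (rule assms)
  ultimately have "g2_torsion br phi
      = (2 * \<delta>) *\<^sub>R phi - form_of e (star_terms vol_terms (dphi_terms \<delta> \<epsilon>1 \<epsilon>2 \<epsilon>3))"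
    by (simp add: g2_torsion_def wedge_zero g2_star_zero)
  also have "\<dots> = form_of e (torsion_terms \<delta> \<epsilon>1 \<epsilon>2 \<epsilon>3)"
    by (simp add: phi_terms_def vol_terms_def dphi_terms_def torsion_terms_def term_eval fun_eq_iff
        form_apply algebra_simps)
  finally show ?thesis .
qed

text \<open>Each \<sigma>_i^- wedges to 0 with \<psi>, while \<sigma>_1^+ \<and> \<psi> = 2
  e^{123467} and e^{67} \<and> \<psi> = e^{123467}; the coefficient -2 \<delta> of e^{67} is exactly
  what cancels \<delta> \<sigma>_1^+, and cyclically.\<close>

lemma curvature_wedge_psi:
  "form_of e (curvature_terms \<delta> \<epsilon>1 \<epsilon>2 \<epsilon>3 i) \<and>\<^sub>f form_of e psi_terms = 0" if "i \<in> {5,6,7}"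
proof -
  have "form_of e (wedge_terms (curvature_terms \<delta> \<epsilon>1 \<epsilon>2 \<epsilon>3 i) psi_terms) = form_of e []"
  proof (rule form_of_eqI)
    show "homogeneous 7 6 (wedge_terms (curvature_terms \<delta> \<epsilon>1 \<epsilon>2 \<epsilon>3 i) psi_terms)"
      using homogeneous_wedge_terms[OF homogeneous_terms(7,2)] by simp
    show "\<forall>is\<in>set (filter (\<lambda>J. length J = 6) (subseqs [1..<Suc 7])).
      coefficient (wedge_terms (curvature_terms \<delta> \<epsilon>1 \<epsilon>2 \<epsilon>3 i) psi_terms) is = coefficient [] is"
      using that unfolding multi_indices_6
      by (elim insertE emptyE) (simp_all add: curvature_terms_def de_terms_def psi_terms_def term_eval)
  qed simp
  then show ?thesis
    using form_of_wedge_form_of[OF homogeneous_terms(7,2)] by simp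
qed

text \<open>The square of de^5 - 2 \<delta> e^{67} is de^5 \<and> de^5 - 4 \<delta> de^5 \<and>
  e^{67}. The first term is the differential of de^5 \<and> e^5, and the three cross terms add up to
  that of -4 \<delta> e^{567}.\<close>

lemma ext_d_torsion:
  assumes "\<And>i. i \<in> {1..7} \<Longrightarrow> ext_d br (e i) = form_of e (de_terms \<delta> \<epsilon>1 \<epsilon>2 \<epsilon>3 i)"
  defines "F \<equiv> \<lambda>i. form_of e (curvature_terms \<delta> \<epsilon>1 \<epsilon>2 \<epsilon>3 i)"
  shows "ext_d br (form_of e (torsion_terms \<delta> \<epsilon>1 \<epsilon>2 \<epsilon>3)) = F 5 \<and>\<^sub>f F 5 + F 6 \<and>\<^sub>f F 6 + F 7 \<and>\<^sub>f F 7"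
proof -
  let ?c = "curvature_terms \<delta> \<epsilon>1 \<epsilon>2 \<epsilon>3"
  let ?FF = "wedge_terms (?c 5) (?c 5) @ wedge_terms (?c 6) (?c 6) @ wedge_terms (?c 7) (?c 7)"
  let ?dT = "ext_d_terms 7 (de_terms \<delta> \<epsilon>1 \<epsilon>2 \<epsilon>3) (torsion_terms \<delta> \<epsilon>1 \<epsilon>2 \<epsilon>3)"
  have "ext_d br (form_of e (torsion_terms \<delta> \<epsilon>1 \<epsilon>2 \<epsilon>3)) = form_of e ?dT"
    by (rule ext_d_form_of[OF homogeneous_terms(6) assms(1) homogeneous_terms(4)])
  also have "\<dots> = form_of e ?FF"
  proof (rule form_of_eqI)
    show "homogeneous 7 4 ?dT"
      by (simp add: ext_d_terms_7 de_terms_def torsion_terms_def term_eval)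
    show "homogeneous 7 4 ?FF"
      using homogeneous_wedge_terms[OF homogeneous_terms(7,7)] by simp
    show "\<forall>is\<in>set (filter (\<lambda>J. length J = 4) (subseqs [1..<Suc 7])). coefficient ?dT is = coefficient ?FF is"
      unfolding multi_indices_4
      by (simp add: ext_d_terms_7 de_terms_def torsion_terms_def curvature_terms_def term_eval algebra_simps)
  qed
  also have "\<dots> = F 5 \<and>\<^sub>f F 5 + F 6 \<and>\<^sub>f F 6 + F 7 \<and>\<^sub>f F 7"
    by (simp add: F_def form_of_wedge_form_of[OF homogeneous_terms(7,7)] add.assoc)
  finally show ?thesis .
qed

end

section \<open>The connection\<close>

lemma bilinear_commutator: "bilinear commutator"
proof -
  have "(X + Y) ** Z = X ** Z + Y ** Z" for X Y Z :: "complex^2^2"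
    by (simp add: vec_eq_iff matrix_matrix_mult_def sum.distrib algebra_simps)
  moreover have "(r *\<^sub>R X) ** Y = r *\<^sub>R (X ** Y)" "X ** (r *\<^sub>R Y) = r *\<^sub>R (X ** Y)"
    for r and X Y :: "complex^2^2"
    by (simp_all add: vec_eq_iff matrix_matrix_mult_def scaleR_sum_right)
  ultimately show ?thesis
    by (auto simp: bilinear_def commutator_def linear_iff matrix_add_ldistrib scaleR_diff_right)
qed

lemma commutator_swap: "commutator X Y = - commutator Y X"
  by (simp add: commutator_def)

lemma commutator_self [simp]: "commutator X X = 0"
  by (simp add: commutator_def)

section \<open>Bracket and Killing form of su(2) in the given basis\<close>

locale su2_basis =
  fixes \<delta> :: real and Y5 Y6 Y7 :: "complex^2^2"
  assumes distinct: "distinct [Y5, Y6, Y7]" and indep: "independent {Y5, Y6, Y7}"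
    and span_Y: "span {Y5, Y6, Y7} = su2" and \<delta>_nonzero: "\<delta> \<noteq> 0"
    and comm_67: "commutator Y6 Y7 = (- 2 * \<delta>) *\<^sub>R Y5"
    and comm_75: "commutator Y7 Y5 = (- 2 * \<delta>) *\<^sub>R Y6"
    and comm_56: "commutator Y5 Y6 = (- 2 * \<delta>) *\<^sub>R Y7"
begin

definition comb :: "real \<Rightarrow> real \<Rightarrow> real \<Rightarrow> complex^2^2" where
  "comb p q r = p *\<^sub>R Y5 + q *\<^sub>R Y6 + r *\<^sub>R Y7"

lemma comb_in_span: "comb p q r \<in> span {Y5, Y6, Y7}"
  unfolding comb_def by (intro span_add span_scale span_base) auto

lemma comb_su2: "comb p q r \<in> su2"
  using comb_in_span span_Y by simp

lemma su2_comb: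
  assumes "X \<in> su2"
  obtains p q r where "X = comb p q r"
proof -
  have "X \<in> span {Y5, Y6, Y7}" using assms span_Y by simp
  then obtain u where "X = (\<Sum>v\<in>{Y5, Y6, Y7}. u v *\<^sub>R v)"
    by (auto simp: span_finite)
  then have "X = comb (u Y5) (u Y6) (u Y7)"
    using distinct by (simp add: comb_def add.assoc)
  then show ?thesis by (rule that)
qed

text \<open>In these coordinates the bracket is -2 \<delta> times the cross product of R^3.\<close>

lemma commutator_comb:
  "commutator (comb p q r) (comb x y z)
     = comb (- 2 * \<delta> * (q * z - r * y)) (- 2 * \<delta> * (r * x - p * z)) (- 2 * \<delta> * (p * y - q * x))"
proof -
  have sw: "commutator Y7 Y6 = (2 * \<delta>) *\<^sub>R Y5" "commutator Y5 Y7 = (2 * \<delta>) *\<^sub>R Y6"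
    "commutator Y6 Y5 = (2 * \<delta>) *\<^sub>R Y7"
    using comm_67 comm_75 comm_56 commutator_swap[of Y7 Y6] commutator_swap[of Y5 Y7]
      commutator_swap[of Y6 Y5] by simp_all
  note B = bilinear_commutator
  show ?thesis
    by (simp add: comb_def bilinear_ladd[OF B] bilinear_radd[OF B] bilinear_lmul[OF B] bilinear_rmul[OF B]
        sw comm_67 comm_75 comm_56 algebra_simps)
qed

lemma representation_comb:
  "representation {Y5, Y6, Y7} (comb p q r) Y5 = p"
  "representation {Y5, Y6, Y7} (comb p q r) Y6 = q"
  "representation {Y5, Y6, Y7} (comb p q r) Y7 = r"
proof -
  let ?S = "{Y5, Y6, Y7}"
  have Y: "Y5 \<in> span ?S" "Y6 \<in> span ?S" "Y7 \<in> span ?S"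
    by (auto intro: span_base)
  have "representation ?S (comb p q r) v = p * representation ?S Y5 v + q * representation ?S Y6 v
      + r * representation ?S Y7 v" for v
    unfolding comb_def using Y
    by (simp add: representation_add[OF indep] representation_scale[OF indep] span_add span_scale)
  then show "representation ?S (comb p q r) Y5 = p" "representation ?S (comb p q r) Y6 = q"
    "representation ?S (comb p q r) Y7 = r"
    using distinct by (auto simp: representation_basis[OF indep])
qed

text \<open>The factor is (-2 \<delta>)^2 times -2: by the double cross product formula, the map
  taking Z to the cross product of X with that of Y and Z has trace -2 times the dot product of X
  and Y.\<close>

lemma killing_form_comb:
  "killing_form su2 commutator (comb p q r) (comb x y z) = - 8 * \<delta>\<^sup>2 * (p * x + q * y + r * z)"
proof -
  let ?f = "\<lambda>Z. commutator (comb p q r) (commutator (comb x y z) Z)"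
  have "linear ?f"
    using bilinear_commutator unfolding bilinear_def by (auto intro: linear_compose[unfolded comp_def])
  moreover have "?f ` su2 \<subseteq> su2"
    by (auto elim!: su2_comb simp: commutator_comb comb_su2)
  ultimately have "killing_form su2 commutator (comb p q r) (comb x y z)
      = (\<Sum>c\<in>{Y5, Y6, Y7}. representation {Y5, Y6, Y7} (?f c) c)"
    unfolding killing_form_def by (intro trace_on_eq indep span_Y) auto
  also have "\<dots> = representation {Y5, Y6, Y7} (?f (comb 1 0 0)) Y5
      + representation {Y5, Y6, Y7} (?f (comb 0 1 0)) Y6 + representation {Y5, Y6, Y7} (?f (comb 0 0 1)) Y7"
    using distinct by (simp add: comb_def)
  also have "\<dots> = - 8 * \<delta>\<^sup>2 * (p * x + q * y + r * z)"
    unfolding commutator_comb representation_comb by (simp add: power2_eq_square algebra_simps)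
  finally show ?thesis .
qed

definition pairing :: "complex^2^2 \<Rightarrow> complex^2^2 \<Rightarrow> real" where
  "pairing X Y = - (1 / (8 * \<delta>\<^sup>2)) * killing_form su2 commutator X Y"

lemma pairing_comb: "pairing (comb p q r) (comb x y z) = p * x + q * y + r * z"
  using \<delta>_nonzero by (simp add: pairing_def killing_form_comb)

text \<open>The cross product with a fixed vector is skew for the dot product.\<close>

lemma ad_invariant_pairing: "ad_invariant su2 commutator pairing"
  unfolding ad_invariant_def
  by (auto elim!: su2_comb simp: commutator_comb pairing_comb algebra_simps)

end

section \<open>The connection form and its curvature\<close>

locale coframe7_su2 = coframe7 e b + su2_basis \<delta> Y5 Y6 Y7
  for e :: "nat \<Rightarrow> 'n::real_vector list \<Rightarrow> real" and b and \<delta> Y5 Y6 Y7 +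
  fixes br :: "'n \<Rightarrow> 'n \<Rightarrow> 'n" and \<epsilon>1 \<epsilon>2 \<epsilon>3 :: real
  assumes de: "i \<in> {1..7} \<Longrightarrow> ext_d br (e i) = form_of e (de_terms \<delta> \<epsilon>1 \<epsilon>2 \<epsilon>3 i)"
begin

definition A :: "'n list \<Rightarrow> complex^2^2" where
  "A vs = comb (e 5 vs) (e 6 vs) (e 7 vs)"

abbreviation F :: "nat \<Rightarrow> 'n list \<Rightarrow> real" where
  "F i \<equiv> form_of e (curvature_terms \<delta> \<epsilon>1 \<epsilon>2 \<epsilon>3 i)"

lemma su2_connection_A: "su2_connection A"
proof -
  have e: "kform 1 (e 5)" "kform 1 (e 6)" "kform 1 (e 7)"
    by (auto intro!: kform_e simp del: One_nat_def)
  have lin: "linear (\<lambda>x. e i (vs[j := x]) *\<^sub>R Y)" if "kform 1 (e i)" "length vs = 1" "j < 1"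
    for i j vs and Y :: "complex^2^2"
  proof -
    have l: "linear (\<lambda>x. e i (vs[j := x]))" by (rule kform_linear[OF that])
    show ?thesis by (rule linearI) (simp_all add: linear_add[OF l] linear_scale[OF l] scaleR_add_left)
  qed
  have "kform 1 A"
    unfolding kform_def
  proof (intro conjI allI impI)
    fix vs :: "'n list" and j :: nat assume "length vs = 1 \<and> j < 1"
    then show "linear (\<lambda>x. A (vs[j := x]))"
      unfolding A_def comb_def using e by (intro linear_compose_add lin) auto
  next
    fix vs :: "'n list" assume "length vs \<noteq> 1"
    then show "A vs = 0"
      using e[THEN kform_eq_0_length] by (simp add: A_def comb_def)
  next
    fix vs :: "'n list" assume "length vs = 1 \<and> \<not> distinct vs"
    then show "A vs = 0"
      using e[THEN kform_eq_0_not_distinct] by (simp add: A_def comb_def)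
  qed
  then show ?thesis
    by (auto simp: su2_connection_def A_def comb_su2)
qed

lemma curvature_A: "curvature br A vs = comb (F 5 vs) (F 6 vs) (F 7 vs)"
proof -
  have dA: "ext_d br A vs = comb (ext_d br (e 5) vs) (ext_d br (e 6) vs) (ext_d br (e 7) vs)"
    by (simp add: ext_d_def A_def comb_def scaleR_sum_left scaleR_sum_right scaleR_add_right sum.distrib)
  \<comment> \<open>The expansion uses products of a form at xs with a form at ys, so each
    coordinate of the cross product contributes two entries. Rewriting e^{76} as - e^{67} then
    doubles the coefficient, which cancels the 1/2 in the curvature.\<close>
  have "commutator (A xs) (A ys) = (\<Sum>(\<theta>, \<eta>, c)\<leftarrow>[(e 6, e 7, (- 2 * \<delta>) *\<^sub>R Y5), (e 7, e 6, (2 * \<delta>) *\<^sub>R Y5),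
      (e 7, e 5, (- 2 * \<delta>) *\<^sub>R Y6), (e 5, e 7, (2 * \<delta>) *\<^sub>R Y6),
      (e 5, e 6, (- 2 * \<delta>) *\<^sub>R Y7), (e 6, e 5, (2 * \<delta>) *\<^sub>R Y7)]. (\<theta> xs * \<eta> ys) *\<^sub>R c)" for xs ys
    unfolding A_def commutator_comb by (simp add: comb_def algebra_simps)
  from wedge_with_expand[of commutator A A, OF this]
  have AA: "wedge_with commutator A A vs
      = comb (- 2 * \<delta> * (monomial e [6,7] vs - monomial e [7,6] vs))
          (- 2 * \<delta> * (monomial e [7,5] vs - monomial e [5,7] vs))
          (- 2 * \<delta> * (monomial e [5,6] vs - monomial e [6,5] vs))"
    by (simp add: e_wedge_e comb_def algebra_simps)
  have sw: "monomial e [j, i] vs = - monomial e [i, j] vs" if "i \<in> {5,6,7}" "j \<in> {5,6,7}" for i j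
  proof -
    have "form_of e [(1, [j, i])] = form_of e [(-1, [i, j])]"
    proof (rule form_of_eqI[of 2])
      show "\<forall>is\<in>set (filter (\<lambda>J. length J = 2) (subseqs [1..<Suc 7])).
          coefficient [(1, [j, i])] is = coefficient [(-1, [i, j])] is"
      proof
        fix "is" :: "nat list" assume "is \<in> set (filter (\<lambda>J. length J = 2) (subseqs [1..<Suc 7]))"
        then have "length is = Suc (Suc 0)" by simp
        then obtain k l where "is = [k, l]"
          by (auto simp: length_Suc_conv)
        then show "coefficient [(1, [j, i])] is = coefficient [(-1, [i, j])] is"
          by (simp add: term_eval)
      qed
    qed (use that in auto)
    then show ?thesis by (simp add: fun_eq_iff form_apply)
  qed
  show ?thesis
    using de[of 5] de[of 6] de[of 7] sw[of 6 7] sw[of 5 7] sw[of 5 6]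
    by (simp add: curvature_def form_apply dA AA curvature_terms_def comb_def algebra_simps)
qed

lemma g2_instanton_A: "g2_instanton br phi A"
proof -
  have "wedge_with (\<lambda>X r. r *\<^sub>R X) (curvature br A) (g2_psi phi) vs = 0" for vs
  proof -
    have "g2_psi phi ys *\<^sub>R curvature br A xs = (\<Sum>(\<theta>, \<eta>, c)\<leftarrow>[(F 5, form_of e psi_terms, Y5),
        (F 6, form_of e psi_terms, Y6), (F 7, form_of e psi_terms, Y7)]. (\<theta> xs * \<eta> ys) *\<^sub>R c)" for xs ys
      by (simp add: curvature_A g2_psi_phi comb_def algebra_simps)
    from wedge_with_expand[of "\<lambda>X r. r *\<^sub>R X", OF this] show ?thesis
      by (simp add: curvature_wedge_psi form_apply)
  qed
  then show ?thesis
    using su2_connection_A by (auto simp: g2_instanton_def fun_eq_iff form_apply)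
qed

lemma heterotic_bianchi_A: "heterotic_bianchi br pairing phi A"
proof -
  have "pairing (curvature br A xs) (curvature br A ys) = (\<Sum>(\<theta>, \<eta>, c)\<leftarrow>[(F 5, F 5, 1),
      (F 6, F 6, 1), (F 7, F 7, 1)]. (\<theta> xs * \<eta> ys) *\<^sub>R c)" for xs ys
    by (simp add: curvature_A pairing_comb)
  from wedge_with_expand[of pairing, OF this]
  have "wedge_with pairing (curvature br A) (curvature br A) = F 5 \<and>\<^sub>f F 5 + F 6 \<and>\<^sub>f F 6 + F 7 \<and>\<^sub>f F 7"
    by (simp add: fun_eq_iff form_apply)
  moreover have "g2_torsion br phi = form_of e (torsion_terms \<delta> \<epsilon>1 \<epsilon>2 \<epsilon>3)"
    by (rule g2_torsion_phi) (rule de)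
  moreover have "ext_d br (form_of e (torsion_terms \<delta> \<epsilon>1 \<epsilon>2 \<epsilon>3)) = F 5 \<and>\<^sub>f F 5 + F 6 \<and>\<^sub>f F 6 + F 7 \<and>\<^sub>f F 7"
    by (rule ext_d_torsion) (rule de)
  ultimately show ?thesis
    by (simp add: heterotic_bianchi_def)
qed

lemma tau0_phi: "tau0 br phi = 12 / 7 * \<delta>"
proof -
  have "g2_star phi (ext_d br phi \<and>\<^sub>f phi) [] = 12 * \<delta>"
    by (rule star_top_phi) (rule de)
  then show ?thesis by (simp add: tau0_def)
qed

end

theorem proposition3p8:
  fixes br :: "'n::real_vector \<Rightarrow> 'n \<Rightarrow> 'n"
    and e :: "nat \<Rightarrow> 'n list \<Rightarrow> real"
    and \<delta> \<epsilon>1 \<epsilon>2 \<epsilon>3 :: real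
    and Y5 Y6 Y7 :: "complex^2^2"
    and \<phi> :: "'n list \<Rightarrow> real"
    and A :: "'n list \<Rightarrow> complex^2^2"
    and pairing :: "complex^2^2 \<Rightarrow> complex^2^2 \<Rightarrow> real"
  assumes "nilpotent_lie_algebra br" and "dim (UNIV :: 'n set) = 7"
    and "dual_basis e 7"
    and "\<And>i. i \<in> {1..4} \<Longrightarrow> ext_d br (e i) = 0"
    and "ext_d br (e 5) = \<delta> *\<^sub>R sigma_plus e 1 + \<epsilon>1 *\<^sub>R sigma_minus e 1"
    and "ext_d br (e 6) = \<delta> *\<^sub>R sigma_plus e 2 + \<epsilon>2 *\<^sub>R sigma_minus e 2"
    and "ext_d br (e 7) = \<delta> *\<^sub>R sigma_plus e 3 + \<epsilon>3 *\<^sub>R sigma_minus e 3"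
    and "\<delta> \<noteq> 0"
    and "\<phi> = sigma_plus e 1 \<and>\<^sub>f e 5 + sigma_plus e 2 \<and>\<^sub>f e 6 + sigma_plus e 3 \<and>\<^sub>f e 7
             + e 5 \<and>\<^sub>f e 6 \<and>\<^sub>f e 7"
    and "distinct [Y5, Y6, Y7]" and "independent {Y5, Y6, Y7}" and "span {Y5, Y6, Y7} = su2"
    and "commutator Y6 Y7 = (- 2 * \<delta>) *\<^sub>R Y5"
    and "commutator Y7 Y5 = (- 2 * \<delta>) *\<^sub>R Y6"
    and "commutator Y5 Y6 = (- 2 * \<delta>) *\<^sub>R Y7"
    and "A = (\<lambda>vs. e 5 vs *\<^sub>R Y5 + e 6 vs *\<^sub>R Y6 + e 7 vs *\<^sub>R Y7)"
    and "pairing = (\<lambda>X Y. - (1 / (8 * \<delta>\<^sup>2)) * killing_form su2 commutator X Y)"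
  shows "g2_structure \<phi> \<and> coclosed br \<phi> \<and> tau0 br \<phi> \<noteq> 0
    \<and> g2_instanton br \<phi> A
    \<and> ad_invariant su2 commutator pairing \<and> heterotic_bianchi br pairing \<phi> A"
proof -
  obtain b where "coframe 7 e b"
    using dual_basis_exists[OF assms(3,2)] by auto
  then interpret coframe7 e b
    using assms(2) by (simp add: coframe7_def coframe7_axioms_def)
  have de: "ext_d br (e i) = form_of e (de_terms \<delta> \<epsilon>1 \<epsilon>2 \<epsilon>3 i)" if "i \<in> {1..7}" for i
  proof -
    have "i \<in> {1..4} \<or> i = 5 \<or> i = 6 \<or> i = 7" using that by auto
    then show ?thesis
    proof (elim disjE)
      \<comment> \<open>The closed covectors e^1, ..., e^4 carry the empty list, which stands for
        the zero form.\<close>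
      assume i: "i \<in> {1..4}"
      then have "de_terms \<delta> \<epsilon>1 \<epsilon>2 \<epsilon>3 i = []" by (simp add: de_terms_def)
      then show ?thesis using assms(4)[OF i] by simp
    qed (simp_all only: assms(5-7) de_eq)
  qed
  interpret I: coframe7_su2 e b \<delta> Y5 Y6 Y7 br \<epsilon>1 \<epsilon>2 \<epsilon>3
    by unfold_locales (use assms(8,10-15) de in auto)
  have "\<phi> = phi" using assms(9) phi_eq by simp
  moreover have "A = I.A" by (simp add: assms(16) fun_eq_iff I.A_def I.comb_def)
  moreover have "pairing = I.pairing" by (simp add: assms(17) fun_eq_iff I.pairing_def)
  moreover have "coclosed br phi"
    by (rule coclosed_phi) (rule de)
  ultimately show ?thesis
    using g2_structure_phi[OF assms(3)] I.tau0_phi assms(8) I.g2_instanton_A I.ad_invariant_pairing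
      I.heterotic_bianchi_A by simp
qed

end
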